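(* Let $X$ be a Hurwitz curve over $\mathbb{C}$ with automorphism group $G=PSL(2,q)$, where $q$ is a prime power relatively prime to $2\cdot3\cdot7$. Let $D=r_1D_1+r_2D_2+r_3D_3+r_7D_7$ be a $G$-invariant divisor ($r_1,r_2,r_3,r_7\in\mathbb{Z}$). Then the equivariant degree $\deg_{eq}(D)$ of $D$ is Galois-invariant if $r_7$ is congruent to $0$, $3$ or $6$ modulo $7$.
   Context: A Hurwitz curve is a smooth projective curve $X$ over $\mathbb{C}$ of genus $g>1$ whose automorphism group has order $84(g-1)$; here that automorphism group is $G=PSL(2,q)$ with $\gcd(q,42)=1$. The quotient map $X\to X/G\cong\mathbb{P}^1$ has exactly three branch points, over which the stabilizers are cyclic of order $2$, $3$, $7$ respectively. For $n\in\{2,3,7\}$ let $D_n$ be the sum (each point with coefficient one) of the points of $X$ whose stabilizer has order $n$ (a single $G$-orbit), and let $D_1$ be the sum of the points of any one $G$-orbit with trivial stabilizers. Equivariant degree. For $P\in X$ let $G_P$ be its stabilizer and $\theta_P$ the ramification character of $G_P$ (the character of $G_P$ on the cotangent space of $X$ at $P$). For the reduced orbit $D_P=\sum_{g\in G/G_P}g(P)$ and $r\in\mathbb{Z}$, $\deg_{eq}(rD_P)$ is the virtual representation of $G$ equal to $\mathrm{Ind}_{G_P}^G\sum_{\ell=1}^{r}\theta_P^{-\ell}$ if $r>0$, to $0$ if $r=0$, and to $-\mathrm{Ind}_{G_P}^G\sum_{\ell=0}^{|r|-1}\theta_P^{\ell}$ if $r<0$ (so that $\deg_{eq}((r+|G_P|)D_P)=\mathbb{C}[G]+\deg_{eq}(rD_P)$).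 It is extended to all $G$-invariant divisors by additivity on disjointly supported divisors. Galois action. Let $\mu$ be a primitive $n$-th root of unity with $n=q(q^2-1)/4$; all character values of $G$ lie in $\mathbb{Q}(\mu)$. The group $\mathcal{G}=\mathrm{Gal}(\mathbb{Q}(\mu)/\mathbb{Q})$ acts on isomorphism classes of irreducible complex representations of $G$ (and, additively, on the Grothendieck group) by sending a representation with character $\chi$ to the one with character $\sigma\circ\chi$, $\sigma\in\mathcal{G}$. A virtual representation is Galois-invariant if it is fixed by this action of $\mathcal{G}$. *)

theory Defs
  imports
    "HOL-Analysis.Analysis"
    "HOL-Library.Function_Algebras"
    "HOL-Algebra.Group_Action"
begin

section \<open>Vector spaces of complex-valued functions\<close>

definition scl :: "complex \<Rightarrow> ('a \<Rightarrow> complex) \<Rightarrow> 'a \<Rightarrow> complex" where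
  "scl c f = (\<lambda>x. c * f x)"

global_interpretation cfun: vector_space scl
  by unfold_locales (auto simp: scl_def fun_eq_iff algebra_simps)

text \<open>The quotient \<open>V/W\<close> has dimension \<open>d\<close>: the classes of some \<open>d\<close> elements of \<open>V\<close>
  form a basis of \<open>V/W\<close>.\<close>

definition quot_dim :: "('a \<Rightarrow> complex) set \<Rightarrow> ('a \<Rightarrow> complex) set \<Rightarrow> nat \<Rightarrow> bool" where
  "quot_dim V W d \<longleftrightarrow>
     (\<exists>B\<subseteq>V. finite B \<and> card B = d \<and>
        (\<forall>v\<in>V. \<exists>!c. c \<in> B \<rightarrow>\<^sub>E (UNIV :: complex set) \<and> v - (\<Sum>b\<in>B. scl (c b) b) \<in> W))"


section \<open>Smooth projective curves\<close>

text \<open>Points of the complex projective space with homogeneous coordinates indexed by \<open>'n\<close>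
  are the lines through the origin of \<open>complex^'n\<close>.\<close>

typedef 'n proj = "{L :: (complex^'n::finite) set. \<exists>v. v \<noteq> 0 \<and> L = range (\<lambda>c. c *s v)}"
  morphisms line Abs_proj
proof -
  have "(\<chi> i. 1 :: complex^'n) \<noteq> 0" by (simp add: vec_eq_iff)
  then show ?thesis by blast
qed

text \<open>Since the ground field is infinite, homogeneous polynomials of degree \<open>d\<close> are identified
  with the functions that they define.\<close>

inductive form :: "nat \<Rightarrow> (complex^'n::finite \<Rightarrow> complex) \<Rightarrow> bool" where
  const: "form 0 (\<lambda>x. a)"
| coord: "form 1 (\<lambda>x. x $ i)"
| add: "form d p \<Longrightarrow> form d q \<Longrightarrow> form d (\<lambda>x. p x + q x)"
| mult: "form d p \<Longrightarrow> form e q \<Longrightarrow> form (d + e) (\<lambda>x. p x * q x)"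

definition zeros :: "(complex^'n::finite \<Rightarrow> complex) set \<Rightarrow> 'n proj set" where
  "zeros S = {P. \<forall>p\<in>S. \<forall>x\<in>line P. p x = 0}"

definition zariski_closed :: "'n::finite proj set \<Rightarrow> bool" where
  "zariski_closed Z \<longleftrightarrow> (\<exists>S. (\<forall>p\<in>S. \<exists>d. form d p) \<and> Z = zeros S)"

definition zariski :: "'n::finite proj topology" where
  "zariski = topology (\<lambda>U. zariski_closed (- U))"

lemma form_homogeneous: "form d p \<Longrightarrow> p (c *s x) = c ^ d * p x"
  by (induction rule: form.induct) (simp_all add: algebra_simps power_add)

lemma zariski_closed_Un:
  assumes "zariski_closed Y" "zariski_closed Z"
  shows "zariski_closed (Y \<union> Z)"
proof -
  obtain S T where S: "\<And>p. p \<in> S \<Longrightarrow> \<exists>d. form d p" "Y = zeros S"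
    and T: "\<And>p. p \<in> T \<Longrightarrow> \<exists>d. form d p" "Z = zeros T"
    using assms unfolding zariski_closed_def by blast
  let ?R = "{\<lambda>x. p x * q x | p q. p \<in> S \<and> q \<in> T}"
  have forms: "\<forall>r\<in>?R. \<exists>d. form d r"
    using S(1) T(1) form.mult by blast
  have "P \<in> Y \<union> Z" if P: "P \<in> zeros ?R" for P
  proof (rule ccontr)
    assume "P \<notin> Y \<union> Z"
    then obtain p x q y where p: "p \<in> S" "x \<in> line P" "p x \<noteq> 0"
      and q: "q \<in> T" "y \<in> line P" "q y \<noteq> 0"
      unfolding S(2) T(2) zeros_def by blast
    obtain v where v: "line P = range (\<lambda>c. c *s v)" using line[of P] by blast
    obtain a b where ab: "x = a *s v" "y = b *s v" using p(2) q(2) v by blast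
    have "p v \<noteq> 0" "q v \<noteq> 0"
      using S(1)[OF p(1)] T(1)[OF q(1)] p(3) q(3) ab by (auto simp: form_homogeneous)
    moreover have "v \<in> line P" unfolding v by (metis rangeI vector_smult_lid)
    ultimately show False using P p(1) q(1) unfolding zeros_def by fastforce
  qed
  moreover have "P \<in> zeros ?R" if "P \<in> Y \<union> Z" for P
    using that unfolding S(2) T(2) zeros_def by auto
  ultimately have "Y \<union> Z = zeros ?R" by blast
  with forms show ?thesis unfolding zariski_closed_def by blast
qed

lemma zariski_closed_Inter:
  assumes "\<And>Z. Z \<in> \<F> \<Longrightarrow> zariski_closed Z"
  shows "zariski_closed (\<Inter>\<F>)"
proof -
  obtain S where S: "\<And>Z. Z \<in> \<F> \<Longrightarrow> (\<forall>p\<in>S Z. \<exists>d. form d p) \<and> Z = zeros (S Z)"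
    using assms unfolding zariski_closed_def by metis
  have "zeros (\<Union>(S ` \<F>)) = \<Inter>(zeros ` S ` \<F>)" unfolding zeros_def by auto
  also have "zeros ` S ` \<F> = \<F>" using S by (auto simp: image_iff)
  finally have "\<Inter>\<F> = zeros (\<Union>(S ` \<F>))" by simp
  moreover have "\<forall>p\<in>\<Union>(S ` \<F>). \<exists>d. form d p" using S by blast
  ultimately show ?thesis unfolding zariski_closed_def by blast
qed

lemma openin_zariski:
  fixes U :: "'n::finite proj set"
  shows "openin zariski U \<longleftrightarrow> zariski_closed (- U)"
proof -
  have "istopology (\<lambda>U :: 'n proj set. zariski_closed (- U))"
    unfolding istopology_def
  proof (intro conjI allI impI)
    fix \<K> :: "'n proj set set"
    assume "\<forall>K\<in>\<K>. zariski_closed (- K)"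
    then have "zariski_closed (\<Inter>(uminus ` \<K>))" by (intro zariski_closed_Inter) auto
    moreover have "- \<Union>\<K> = \<Inter>(uminus ` \<K>)" by auto
    ultimately show "zariski_closed (- \<Union>\<K>)" by simp
  qed (simp add: Compl_Int zariski_closed_Un)
  then show ?thesis by (simp add: zariski_def topology_inverse')
qed

definition irreducible_closed :: "'n::finite proj set \<Rightarrow> bool" where
  "irreducible_closed Z \<longleftrightarrow> closedin zariski Z \<and> Z \<noteq> {} \<and>
     (\<forall>A B. closedin zariski A \<and> closedin zariski B \<and> Z \<subseteq> A \<union> B \<longrightarrow> Z \<subseteq> A \<or> Z \<subseteq> B)"

definition has_chain :: "'n::finite proj set \<Rightarrow> nat \<Rightarrow> bool" where
  "has_chain X n \<longleftrightarrow>
     (\<exists>Z. (\<forall>i\<le>n. irreducible_closed (Z i) \<and> Z i \<subseteq> X) \<and> (\<forall>i<n. Z i \<subset> Z (Suc i)))"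

definition krull_dim :: "'n::finite proj set \<Rightarrow> nat \<Rightarrow> bool" where
  "krull_dim X n \<longleftrightarrow> has_chain X n \<and> \<not> has_chain X (Suc n)"

text \<open>Elements of the local ring of \<open>X\<close> at \<open>P\<close> are represented by functions on the whole
  projective space whose values matter only on a neighbourhood of \<open>P\<close> in \<open>X\<close>; the germ is
  recovered after passing to the quotients below.\<close>

definition regular_at :: "'n::finite proj set \<Rightarrow> 'n proj \<Rightarrow> ('n proj \<Rightarrow> complex) \<Rightarrow> bool" where
  "regular_at X P f \<longleftrightarrow>
     (\<exists>U d p q. openin (subtopology zariski X) U \<and> P \<in> U \<and> form d p \<and> form d q \<and>
        (\<forall>Q\<in>U. \<forall>x\<in>line Q. x \<noteq> 0 \<longrightarrow> q x \<noteq> 0 \<and> f Q = p x / q x))"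

definition max_ideal :: "'n::finite proj set \<Rightarrow> 'n proj \<Rightarrow> ('n proj \<Rightarrow> complex) set" where
  "max_ideal X P = {f. regular_at X P f \<and> f P = 0}"

definition max_ideal_sq :: "'n::finite proj set \<Rightarrow> 'n proj \<Rightarrow> ('n proj \<Rightarrow> complex) set" where
  "max_ideal_sq X P =
     {f. \<exists>U k a b. openin (subtopology zariski X) U \<and> P \<in> U \<and>
        (\<forall>i<k. a i \<in> max_ideal X P \<and> b i \<in> max_ideal X P) \<and>
        (\<forall>Q\<in>U. f Q = (\<Sum>i<(k::nat). a i Q * b i Q))}"

text \<open>The quotient \<open>max_ideal X P / max_ideal_sq X P\<close> is the cotangent space of \<open>X\<close> at \<open>P\<close>:
  a function whose germ at \<open>P\<close> vanishes lies in \<open>max_ideal_sq X P\<close> (take \<open>k = 0\<close>).\<close>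

definition smooth_projective_curve :: "'n::finite proj set \<Rightarrow> bool" where
  "smooth_projective_curve X \<longleftrightarrow> irreducible_closed X \<and> krull_dim X 1 \<and>
     (\<forall>P\<in>X. quot_dim (max_ideal X P) (max_ideal_sq X P) 1)"

text \<open>A family of cotangent vectors, one for each \<open>P\<close>, is represented by a function \<open>\<omega>\<close> with
  \<open>\<omega> (P, _)\<close> in \<open>max_ideal X P\<close>, read modulo \<open>max_ideal_sq X P\<close>. It is a regular differential
  if it is locally \<open>\<Sum> f\<^sub>i dg\<^sub>i\<close>, where the value of \<open>dg\<close> at \<open>Q\<close> is the class
  of \<open>g - g Q\<close>.\<close>

definition regular_forms :: "'n::finite proj set \<Rightarrow> ('n proj \<times> 'n proj \<Rightarrow> complex) set" where
  "regular_forms X =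
     {\<omega>. (\<forall>P\<in>X. (\<lambda>R. \<omega> (P, R)) \<in> max_ideal X P) \<and>
        (\<forall>P\<in>X. \<exists>U k f g. openin (subtopology zariski X) U \<and> P \<in> U \<and>
           (\<forall>i<k. \<forall>Q\<in>U. regular_at X Q (f i) \<and> regular_at X Q (g i)) \<and>
           (\<forall>Q\<in>U. (\<lambda>R. \<omega> (Q, R) - (\<Sum>i<(k::nat). f i Q * (g i R - g i Q))) \<in> max_ideal_sq X Q))}"

definition zero_forms :: "'n::finite proj set \<Rightarrow> ('n proj \<times> 'n proj \<Rightarrow> complex) set" where
  "zero_forms X = {\<omega>. \<forall>P\<in>X. (\<lambda>R. \<omega> (P, R)) \<in> max_ideal_sq X P}"

definition has_genus :: "'n::finite proj set \<Rightarrow> nat \<Rightarrow> bool" where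
  "has_genus X g \<longleftrightarrow> quot_dim (regular_forms X) (zero_forms X) g"


section \<open>Automorphisms and Hurwitz curves\<close>

definition morphism ::
  "'n::finite proj set \<Rightarrow> 'm::finite proj set \<Rightarrow> ('n proj \<Rightarrow> 'm proj) \<Rightarrow> bool" where
  "morphism X Y \<phi> \<longleftrightarrow>
     continuous_map (subtopology zariski X) (subtopology zariski Y) \<phi> \<and>
     (\<forall>P\<in>X. \<forall>f. regular_at Y (\<phi> P) f \<longrightarrow> regular_at X P (f \<circ> \<phi>))"

definition aut_group :: "'n::finite proj set \<Rightarrow> ('n proj \<Rightarrow> 'n proj) monoid" where
  "aut_group X =
     BijGroup X \<lparr>carrier := {\<phi> \<in> Bij X. morphism X X \<phi> \<and> morphism X X (inv_into X \<phi>)}\<rparr>"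

definition hurwitz_curve :: "'n::finite proj set \<Rightarrow> bool" where
  "hurwitz_curve X \<longleftrightarrow> smooth_projective_curve X \<and>
     (\<exists>g>1. has_genus X g \<and> order (aut_group X) = 84 * (g - 1))"

abbreviation stab :: "'n::finite proj set \<Rightarrow> 'n proj \<Rightarrow> ('n proj \<Rightarrow> 'n proj) set" where
  "stab X P \<equiv> stabilizer (aut_group X) (\<lambda>g. g) P"

text \<open>An automorphism \<open>g\<close> acts on functions by \<open>f \<mapsto> f \<circ> g\<^sup>-\<^sup>1\<close>. On a smooth curve the
  cotangent space at \<open>P\<close> is one-dimensional, so the character of \<open>stab X P\<close> on it is the
  scalar by which the group acts.\<close>

definition ram_char ::
  "'n::finite proj set \<Rightarrow> 'n proj \<Rightarrow> ('n proj \<Rightarrow> 'n proj) \<Rightarrow> complex" where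
  "ram_char X P g =
     (THE c. \<forall>f\<in>max_ideal X P.
        (\<lambda>Q. f ((inv\<^bsub>aut_group X\<^esub> g) Q) - c * f Q) \<in> max_ideal_sq X P)"


section \<open>The groups PSL(2,q)\<close>

definition SL2 :: "('f::field^2^2) monoid" where
  "SL2 = \<lparr>carrier = {A. det A = 1}, mult = (**), one = mat 1\<rparr>"

definition PSL2 :: "('f::field^2^2) set monoid" where
  "PSL2 = SL2 Mod {A \<in> carrier SL2. \<exists>c. A = mat c}"


section \<open>Representations and virtual representations\<close>

text \<open>A finite-dimensional representation is a pair of a space of complex-valued functions and
  an action on it. Every such representation is isomorphic to one with \<open>'a = nat\<close>.\<close>

type_synonym ('g, 'a) rep = "('a \<Rightarrow> complex) set \<times> ('g \<Rightarrow> ('a \<Rightarrow> complex) \<Rightarrow> 'a \<Rightarrow> complex)"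

definition linear_map_on ::
  "('a \<Rightarrow> complex) set \<Rightarrow> ('b \<Rightarrow> complex) set \<Rightarrow> (('a \<Rightarrow> complex) \<Rightarrow> 'b \<Rightarrow> complex) \<Rightarrow> bool" where
  "linear_map_on V W F \<longleftrightarrow> F \<in> V \<rightarrow> W \<and>
     (\<forall>u\<in>V. \<forall>v\<in>V. F (u + v) = F u + F v) \<and> (\<forall>c. \<forall>v\<in>V. F (scl c v) = scl c (F v))"

definition is_rep :: "'g monoid \<Rightarrow> ('g, 'a) rep \<Rightarrow> bool" where
  "is_rep G = (\<lambda>(V, \<rho>).
     (\<exists>B. finite B \<and> V = cfun.span B) \<and>
     (\<forall>g\<in>carrier G. linear_map_on V V (\<rho> g)) \<and>
     (\<forall>v\<in>V. \<rho> \<one>\<^bsub>G\<^esub> v = v) \<and>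
     (\<forall>g\<in>carrier G. \<forall>h\<in>carrier G. \<forall>v\<in>V. \<rho> (g \<otimes>\<^bsub>G\<^esub> h) v = \<rho> g (\<rho> h v)))"

definition irrep :: "'g monoid \<Rightarrow> ('g, 'a) rep \<Rightarrow> bool" where
  "irrep G = (\<lambda>(V, \<rho>). is_rep G (V, \<rho>) \<and> V \<noteq> {0} \<and>
     (\<forall>W. cfun.subspace W \<and> W \<subseteq> V \<and> (\<forall>g\<in>carrier G. \<forall>w\<in>W. \<rho> g w \<in> W) \<longrightarrow> W = {0} \<or> W = V))"

definition trace_on ::
  "('a \<Rightarrow> complex) set \<Rightarrow> (('a \<Rightarrow> complex) \<Rightarrow> 'a \<Rightarrow> complex) \<Rightarrow> complex" where
  "trace_on V T =
     (let B = (SOME B. cfun.independent B \<and> cfun.span B = V)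
      in \<Sum>b\<in>B. cfun.representation B (T b) b)"

definition rep_char :: "('g, 'a) rep \<Rightarrow> 'g \<Rightarrow> complex" where
  "rep_char = (\<lambda>(V, \<rho>) g. trace_on V (\<rho> g))"

text \<open>Intertwiners are set to \<open>0\<close> outside the source, so that distinct ones differ there.\<close>

definition intertwiners ::
  "'g monoid \<Rightarrow> ('g, 'a) rep \<Rightarrow> ('g, 'b) rep \<Rightarrow> (('a \<Rightarrow> complex) \<Rightarrow> 'b \<Rightarrow> complex) set" where
  "intertwiners G = (\<lambda>(V, \<rho>) (W, \<tau>).
     {F. linear_map_on V W F \<and> (\<forall>v. v \<notin> V \<longrightarrow> F v = 0) \<and>
         (\<forall>g\<in>carrier G. \<forall>v\<in>V. F (\<rho> g v) = \<tau> g (F v))})"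

text \<open>For a finite group \<open>G\<close> the Grothendieck group of complex representations is free abelian
  on the isomorphism classes of irreducible representations. A virtual representation is given
  by its coefficients in this basis; the coefficient of the class of a representation \<open>W\<close> at an
  irreducible \<open>S\<close> is the multiplicity of \<open>S\<close> in \<open>W\<close>, which is the dimension of the space of
  intertwiners from \<open>S\<close> to \<open>W\<close>. Values at arguments that are not irreducible are
  irrelevant.\<close>

type_synonym 'g vrep = "('g, nat) rep \<Rightarrow> int"

definition rep_class :: "'g monoid \<Rightarrow> ('g, 'a) rep \<Rightarrow> 'g vrep" where
  "rep_class G W = (\<lambda>S. int (cfun.dim (case_prod ` intertwiners G S W)))"

text \<open>The representation induced from a one-dimensional character \<open>\<theta>\<close> of a subgroup \<open>H\<close>.\<close>

definition Ind :: "'g monoid \<Rightarrow> 'g set \<Rightarrow> ('g \<Rightarrow> complex) \<Rightarrow> ('g, 'g) rep" where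
  "Ind G H \<theta> =
     ({f. (\<forall>x. x \<notin> carrier G \<longrightarrow> f x = 0) \<and>
          (\<forall>x\<in>carrier G. \<forall>h\<in>H. f (x \<otimes>\<^bsub>G\<^esub> h) = inverse (\<theta> h) * f x)},
      \<lambda>g f x. if x \<in> carrier G then f (inv\<^bsub>G\<^esub> g \<otimes>\<^bsub>G\<^esub> x) else 0)"


section \<open>Equivariant degree\<close>

definition deg_eq_orbit ::
  "'n::finite proj set \<Rightarrow> 'n proj \<Rightarrow> int \<Rightarrow> ('n proj \<Rightarrow> 'n proj) vrep" where
  "deg_eq_orbit X P r =
     (let ind = (\<lambda>l::int. rep_class (aut_group X)
                   (Ind (aut_group X) (stab X P) (\<lambda>h. ram_char X P h powi l)))
      in if r > 0 then (\<Sum>l\<in>{1..r}. ind (- l))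
         else if r = 0 then 0
         else - (\<Sum>l\<in>{0..\<bar>r\<bar> - 1}. ind l))"

text \<open>A divisor is given by its coefficient function. The sum runs over the orbits in the
  support of the invariant divisor \<open>D\<close>; neither the coefficient nor the summand depends on the
  point chosen in the orbit.\<close>

definition deg_eq ::
  "'n::finite proj set \<Rightarrow> ('n proj \<Rightarrow> int) \<Rightarrow> ('n proj \<Rightarrow> 'n proj) vrep" where
  "deg_eq X D =
     (\<Sum>Y | Y \<in> orbits (aut_group X) X (\<lambda>g. g) \<and> (\<exists>P\<in>Y. D P \<noteq> 0).
        let P = (SOME P. P \<in> Y) in deg_eq_orbit X P (D P))"

definition reduced_divisor :: "'n::finite proj set \<Rightarrow> 'n proj \<Rightarrow> int" where
  "reduced_divisor A = (\<lambda>P. if P \<in> A then 1 else 0)"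

definition stab_divisor :: "'n::finite proj set \<Rightarrow> nat \<Rightarrow> 'n proj \<Rightarrow> int" where
  "stab_divisor X n = reduced_divisor {P \<in> X. card (stab X P) = n}"


section \<open>Galois action\<close>

definition primitive_root_of_unity :: "nat \<Rightarrow> complex \<Rightarrow> bool" where
  "primitive_root_of_unity n \<mu> \<longleftrightarrow> n > 0 \<and> \<mu> ^ n = 1 \<and> (\<forall>k. 0 < k \<and> k < n \<longrightarrow> \<mu> ^ k \<noteq> 1)"

definition complex_subfield :: "complex set \<Rightarrow> bool" where
  "complex_subfield K \<longleftrightarrow> 0 \<in> K \<and> 1 \<in> K \<and>
     (\<forall>x\<in>K. \<forall>y\<in>K. x - y \<in> K \<and> x * y \<in> K) \<and> (\<forall>x\<in>K. inverse x \<in> K)"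

definition Q_adjoin :: "complex \<Rightarrow> complex set" where
  "Q_adjoin \<mu> = \<Inter>{K. complex_subfield K \<and> \<mu> \<in> K}"

definition gal :: "complex set \<Rightarrow> (complex \<Rightarrow> complex) set" where
  "gal K = {\<sigma>. bij_betw \<sigma> K K \<and>
     (\<forall>x\<in>K. \<forall>y\<in>K. \<sigma> (x + y) = \<sigma> x + \<sigma> y \<and> \<sigma> (x * y) = \<sigma> x * \<sigma> y) \<and> (\<forall>x\<in>\<rat>. \<sigma> x = x)}"

text \<open>\<open>S'\<close> represents the image of the class of \<open>S\<close> under \<open>\<sigma>\<close>.\<close>

definition galois_conjugate ::
  "'g monoid \<Rightarrow> (complex \<Rightarrow> complex) \<Rightarrow> ('g, nat) rep \<Rightarrow> ('g, nat) rep \<Rightarrow> bool" where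
  "galois_conjugate G \<sigma> S S' \<longleftrightarrow> irrep G S \<and> irrep G S' \<and>
     (\<forall>g\<in>carrier G. rep_char S' g = \<sigma> (rep_char S g))"

text \<open>The coefficient of \<open>\<sigma> v\<close> at the image of \<open>S\<close> under \<open>\<sigma>\<close> is the coefficient of \<open>v\<close> at
  \<open>S\<close>; so \<open>\<sigma>\<close> fixes \<open>v\<close> iff conjugate irreducibles have the same coefficient in \<open>v\<close>.\<close>

definition galois_invariant :: "'g monoid \<Rightarrow> complex set \<Rightarrow> 'g vrep \<Rightarrow> bool" where
  "galois_invariant G K v \<longleftrightarrow>
     (\<forall>\<sigma>\<in>gal K. \<forall>S S'. galois_conjugate G \<sigma> S S' \<longrightarrow> v S' = v S)"

end

theory Submission
  imports Defs "HOL-Number_Theory.Residues"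
begin

text \<open>
  Let \<open>P\<close> be a point with stabilizer \<open>H\<close> of order \<open>p\<close> and ramification character \<open>\<theta>\<close>. By Frobenius
  reciprocity the coefficient of \<open>deg\<^sub>e\<^sub>q (r D\<^sub>P)\<close> at an irreducible representation with
  character \<open>\<chi>\<close> is \<open>1/p\<close> times the sum of \<open>\<chi> h * c (\<theta> h)\<close> over \<open>h \<in> H\<close>, where
  \<open>c z = z + z\<^sup>2 + \<dots> + z\<^sup>r\<close>, suitably continued to \<open>r \<le> 0\<close>
  (\<open>frobenius_reciprocity_character\<close>, \<open>ram_induced_coefficient\<close>).

  The numbers \<open>c z\<close> are irrational in general, but in \<open>PSL(2,q)\<close> with \<open>q\<close> odd an element of order
  prime to \<open>q\<close> is conjugate to its inverse (\<open>PSL2_conjugate_to_inverse\<close>), so that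
  \<open>\<chi> h = \<chi> (h\<^sup>-\<^sup>1)\<close> and only \<open>c z + c (1/z)\<close> matters. For a \<open>p\<close>-th root of unity \<open>z \<noteq> 1\<close> a geometric
  sum shows
  \<open>c z + c (1/z) = (z\<^sup>r\<^sup>+\<^sup>1 - z\<^sup>-\<^sup>r) / (z - 1) - 1\<close>,
  and this is the integer \<open>0\<close>, \<open>-2\<close> or \<open>-1\<close>, the same for all such \<open>z\<close>, when \<open>p\<close> divides \<open>r\<close>, \<open>r + 1\<close>
  or \<open>2 r + 1\<close> (\<open>ram_sum_symmetrised_constant\<close>). For \<open>p = 7\<close> these are the residues \<open>0\<close>, \<open>6\<close> and
  \<open>3\<close>; for \<open>p \<in> {1, 2, 3}\<close> they are all residues. Twice the coefficient is then a rational
  combination, independent of \<open>\<chi>\<close>, of the sums of \<open>\<chi>\<close> over the two subgroups \<open>H\<close> and \<open>ker \<theta>\<close>.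

  The sum of \<open>\<chi>\<close> over a subgroup \<open>U\<close> is \<open>|U|\<close> times the multiplicity of the trivial character of
  \<open>U\<close>, hence an integer, which every \<open>\<sigma>\<close> in the Galois group fixes. On the other hand \<open>\<sigma>\<close> carries it to the
  same sum for the conjugate character, because on \<open>H\<close> the values of \<open>\<chi>\<close> are integer combinations of
  \<open>p\<close>-th roots of unity and these lie in \<open>\<rat>(\<mu>)\<close>: the number \<open>84 (g - 1) = |G|\<close> divides
  \<open>|SL(2,q)| = q (q\<^sup>2 - 1)\<close>, whence \<open>42\<close> divides \<open>q (q\<^sup>2 - 1) / 4\<close>. So both subgroup sums, and
  with them the coefficient, are the same for conjugate representations. Summing over the orbits
  in the support of the divisor gives the theorem.
\<close>


section \<open>Traces and idempotents\<close>

lemma sum_fun_apply: "(\<Sum>i\<in>I. f i) x = (\<Sum>i\<in>I. f i x)"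
  for f :: "'i \<Rightarrow> 'a \<Rightarrow> 'b::comm_monoid_add"
  by (induction I rule: infinite_finite_induct) auto

lemma scl_apply: "scl c f x = c * f x"
  by (simp add: scl_def)

definition basis_of :: "('a \<Rightarrow> complex) set \<Rightarrow> ('a \<Rightarrow> complex) set \<Rightarrow> bool" where
  "basis_of B V \<longleftrightarrow> finite B \<and> cfun.independent B \<and> cfun.span B = V"

lemma basis_of_subset: "basis_of B V \<Longrightarrow> b \<in> B \<Longrightarrow> b \<in> V"
  using cfun.span_base by (auto simp: basis_of_def)

lemma basis_of_expansion:
  "basis_of B V \<Longrightarrow> v \<in> V \<Longrightarrow> (\<Sum>b\<in>B. scl (cfun.representation B v b) b) = v"
  unfolding basis_of_def by (intro cfun.sum_representation_eq) auto

lemma extend_to_basis: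
  assumes "finite A" "V = cfun.span A" "S \<subseteq> V" "cfun.independent S"
  obtains B where "S \<subseteq> B" "basis_of B V"
proof -
  obtain B where B: "S \<subseteq> B" "B \<subseteq> V" "cfun.independent B" "V \<subseteq> cfun.span B"
    using cfun.maximal_independent_subset_extend[OF assms(3,4)] by blast
  have "finite B" using cfun.independent_span_bound[OF assms(1) B(3)] B(2) assms(2) by blast
  moreover have "cfun.span B = V"
    using B assms(2) by (metis cfun.span_minimal cfun.subspace_span subset_antisym)
  ultimately show ?thesis using that B by (auto simp: basis_of_def)
qed

lemma linear_map_on_sum_scl:
  assumes lin: "linear_map_on V W F" and V: "cfun.subspace V" and v: "\<And>i. i \<in> I \<Longrightarrow> v i \<in> V"
  shows "F (\<Sum>i\<in>I. scl (c i) (v i)) = (\<Sum>i\<in>I. scl (c i) (F (v i)))"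
proof -
  have zero: "F 0 = 0"
    using lin cfun.subspace_0[OF V] unfolding linear_map_on_def
    by (metis cfun.scale_zero_left)
  show ?thesis using v
  proof (induction I rule: infinite_finite_induct)
    case (insert i I)
    have "(\<Sum>i\<in>I. scl (c i) (v i)) \<in> V" "scl (c i) (v i) \<in> V"
      using insert.prems by (auto intro!: cfun.subspace_sum cfun.subspace_scale V)
    then have "F (scl (c i) (v i) + (\<Sum>i\<in>I. scl (c i) (v i))) =
        scl (c i) (F (v i)) + F (\<Sum>i\<in>I. scl (c i) (v i))"
      using lin insert.prems unfolding linear_map_on_def by auto
    then show ?case
      using insert.IH insert.prems by (simp only: sum.insert[OF insert.hyps] insert_iff simp_thms)
  qed (auto simp: zero)
qed

lemma linear_map_on_comp:
  "linear_map_on U V F \<Longrightarrow> linear_map_on V W G \<Longrightarrow> linear_map_on U W (\<lambda>v. G (F v))"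
  unfolding linear_map_on_def by (auto simp: Pi_iff)

lemma linear_map_on_sum:
  assumes "cfun.subspace V" "\<And>i. i \<in> I \<Longrightarrow> linear_map_on V V (T i)"
  shows "linear_map_on V V (\<lambda>v. \<Sum>i\<in>I. scl (c i) (T i v))"
  unfolding linear_map_on_def
proof (intro conjI ballI allI)
  show "(\<lambda>v. \<Sum>i\<in>I. scl (c i) (T i v)) \<in> V \<rightarrow> V"
    using assms unfolding linear_map_on_def by (blast intro: cfun.subspace_sum cfun.subspace_scale)
qed (use assms in \<open>auto simp: linear_map_on_def cfun.scale_right_distrib sum.distrib
       cfun.scale_sum_right mult.commute intro!: sum.cong\<close>)

lemma representation_sum_scl:
  assumes "cfun.independent B" "\<And>i. i \<in> I \<Longrightarrow> v i \<in> cfun.span B"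
  shows "cfun.representation B (\<Sum>i\<in>I. scl (c i) (v i)) b =
    (\<Sum>i\<in>I. c i * cfun.representation B (v i) b)"
  using assms
  by (simp add: cfun.representation_sum cfun.representation_scale cfun.span_scale)

lemma representation_linear_map:
  assumes B: "basis_of B V" and C: "basis_of C V" and T: "linear_map_on V V T" and v: "v \<in> V"
  shows "cfun.representation B (T v) b =
    (\<Sum>c\<in>C. cfun.representation C v c * cfun.representation B (T c) b)"
proof -
  have V: "cfun.subspace V" using B by (auto simp: basis_of_def)
  have TV: "T c \<in> V" if "c \<in> V" for c using T that by (auto simp: linear_map_on_def)
  have "T v = (\<Sum>c\<in>C. scl (cfun.representation C v c) (T c))"
    using linear_map_on_sum_scl[OF T V, of C "\<lambda>c. c" "cfun.representation C v"]
      basis_of_subset[OF C] basis_of_expansion[OF C v] by simp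
  then show ?thesis
    using B TV basis_of_subset[OF C] by (simp add: representation_sum_scl basis_of_def)
qed

text \<open>Both facts about traces that are needed are instances of this identity: independence of the
  basis (\<open>S\<close> the identity) and \<open>tr (S T) = tr (T S)\<close> (\<open>B = C\<close>). Expanding \<open>T b\<close> in \<open>C\<close> on the left and
  \<open>S c\<close> in \<open>B\<close> on the right gives the same double sum.\<close>

lemma sum_diagonal_swap:
  assumes B: "basis_of B V" and C: "basis_of C V"
    and S: "linear_map_on V V S" and T: "linear_map_on V V T"
  shows "(\<Sum>b\<in>B. cfun.representation B (S (T b)) b) = (\<Sum>c\<in>C. cfun.representation C (T (S c)) c)"
proof -
  have mem: "S v \<in> V" "T v \<in> V" if "v \<in> V" for v using S T that by (auto simp: linear_map_on_def)
  have "(\<Sum>b\<in>B. cfun.representation B (S (T b)) b) =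
      (\<Sum>b\<in>B. \<Sum>c\<in>C. cfun.representation C (T b) c * cfun.representation B (S c) b)"
    by (intro sum.cong refl representation_linear_map[OF B C S] mem basis_of_subset[OF B])
  also have "\<dots> = (\<Sum>c\<in>C. \<Sum>b\<in>B. cfun.representation B (S c) b * cfun.representation C (T b) c)"
    by (subst sum.swap) (simp add: mult.commute)
  also have "\<dots> = (\<Sum>c\<in>C. cfun.representation C (T (S c)) c)"
    by (intro sum.cong refl representation_linear_map[OF C B T, symmetric] mem basis_of_subset[OF C])
  finally show ?thesis .
qed

lemma trace_on_basis:
  assumes B: "basis_of B V" and T: "linear_map_on V V T"
  shows "trace_on V T = (\<Sum>b\<in>B. cfun.representation B (T b) b)"
proof -
  define C where "C = (SOME C. cfun.independent C \<and> cfun.span C = V)"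
  have "cfun.independent B \<and> cfun.span B = V" using B by (auto simp: basis_of_def)
  then have C: "cfun.independent C \<and> cfun.span C = V" unfolding C_def by (rule someI)
  then have "finite C"
    using B cfun.independent_span_bound[of B C] cfun.span_superset[of C] by (auto simp: basis_of_def)
  with C have C': "basis_of C V" by (simp add: basis_of_def)
  have id: "linear_map_on V V (\<lambda>v. v)" by (auto simp: linear_map_on_def)
  show ?thesis
    using sum_diagonal_swap[OF C' B id T] by (simp add: trace_on_def C_def[symmetric] Let_def)
qed

lemma trace_on_commute:
  assumes "basis_of B V" "linear_map_on V V S" "linear_map_on V V T"
  shows "trace_on V (\<lambda>v. S (T v)) = trace_on V (\<lambda>v. T (S v))"
  using sum_diagonal_swap[OF assms(1,1,2,3)]
  by (simp add: trace_on_basis[OF assms(1)] linear_map_on_comp[OF assms(2,3)]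
      linear_map_on_comp[OF assms(3,2)])

lemma linear_map_on_cong:
  "linear_map_on V W F \<Longrightarrow> (\<And>v. v \<in> V \<Longrightarrow> F v = G v) \<Longrightarrow> cfun.subspace V \<Longrightarrow> linear_map_on V W G"
  unfolding linear_map_on_def by (auto simp: Pi_iff cfun.subspace_add cfun.subspace_scale)

lemma trace_on_cong:
  assumes B: "basis_of B V" and F: "linear_map_on V V F" and eq: "\<And>v. v \<in> V \<Longrightarrow> F v = G v"
  shows "trace_on V F = trace_on V G"
proof -
  have "linear_map_on V V G"
    using linear_map_on_cong[OF F eq] B by (auto simp: basis_of_def)
  then show ?thesis
    using F eq basis_of_subset[OF B] by (simp add: trace_on_basis[OF B])
qed

lemma trace_on_sum_scl:
  assumes B: "basis_of B V" and T: "\<And>i. i \<in> I \<Longrightarrow> linear_map_on V V (T i)"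
  shows "trace_on V (\<lambda>v. \<Sum>i\<in>I. scl (c i) (T i v)) = (\<Sum>i\<in>I. c i * trace_on V (T i))"
proof -
  have V: "cfun.subspace V" using B by (auto simp: basis_of_def)
  have TV: "T i v \<in> cfun.span B" if "i \<in> I" "v \<in> B" for i v
    using T[OF that(1)] basis_of_subset[OF B that(2)] B by (auto simp: linear_map_on_def basis_of_def)
  have "trace_on V (\<lambda>v. \<Sum>i\<in>I. scl (c i) (T i v)) =
      (\<Sum>b\<in>B. \<Sum>i\<in>I. c i * cfun.representation B (T i b) b)"
    using B TV
    by (simp add: trace_on_basis[OF B linear_map_on_sum[OF V T]] basis_of_def representation_sum_scl)
  also have "\<dots> = (\<Sum>i\<in>I. c i * (\<Sum>b\<in>B. cfun.representation B (T i b) b))"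
    by (subst sum.swap) (simp add: sum_distrib_left)
  finally show ?thesis by (simp add: trace_on_basis[OF B T])
qed

text \<open>A basis \<open>C\<close> of the image of an idempotent extends to a basis of the space. The elements of \<open>C\<close>
  contribute \<open>1\<close> each to the trace, and the others contribute \<open>0\<close> because the image is spanned by
  \<open>C\<close>. So traces of projections count dimensions, and in particular they are natural numbers.\<close>

lemma basis_adapted_to_idempotent:
  assumes A: "finite A" "V = cfun.span A"
    and E: "linear_map_on V V E" "\<And>v. v \<in> V \<Longrightarrow> E (E v) = E v"
  obtains B C where "basis_of B V" "C \<subseteq> B" "\<And>b. b \<in> C \<Longrightarrow> E b = b"
    "\<And>v. v \<in> V \<Longrightarrow> E v \<in> cfun.span C" "trace_on V E = of_nat (card C)"
proof -
  have V: "cfun.subspace V" using A by simp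
  obtain C where C: "C \<subseteq> E ` V" "cfun.independent C" "E ` V \<subseteq> cfun.span C"
    using cfun.maximal_independent_subset by blast
  have "C \<subseteq> V" using C(1) E(1) by (auto simp: linear_map_on_def)
  then obtain B where B: "C \<subseteq> B" "basis_of B V" using extend_to_basis[OF A _ C(2)] by metis
  have fix': "E b = b" if "b \<in> C" for b using C(1) E(2) that by auto
  have im: "E v \<in> cfun.span C" if "v \<in> V" for v using C(3) that by auto
  have B': "finite B" "cfun.independent B" "finite C"
    using B by (auto simp: basis_of_def intro: finite_subset)
  have "cfun.representation B (E b) b = (if b \<in> C then 1 else 0)" if b: "b \<in> B" for b
  proof (cases "b \<in> C")
    case True
    then show ?thesis using cfun.representation_basis[OF B'(2) b] fix' by simp
  next
    case False
    have "cfun.representation B (E b) = cfun.representation C (E b)"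
      by (rule cfun.representation_extend[OF B'(2) im B(1)]) (rule basis_of_subset[OF B(2) b])
    then show ?thesis using False cfun.representation_ne_zero by metis
  qed
  then have "trace_on V E = (\<Sum>b\<in>B. if b \<in> C then 1 else 0)"
    by (simp add: trace_on_basis[OF B(2) E(1)])
  also have "\<dots> = of_nat (card C)"
    using B(1) B' by (simp add: sum.If_cases Int_absorb1 Int_commute)
  finally show ?thesis using that[OF B(2,1) fix' im] by simp
qed

text \<open>Evaluation at the points \<open>x j\<close> plays the role of a dual basis.\<close>

lemma independent_dual_family:
  fixes f :: "'i \<Rightarrow> 'a \<Rightarrow> complex"
  assumes I: "finite I" and dual: "\<And>i j. i \<in> I \<Longrightarrow> j \<in> I \<Longrightarrow> f i (x j) = (if i = j then 1 else 0)"
  shows "inj_on f I" "cfun.independent (f ` I)"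
proof -
  show inj: "inj_on f I"
    using dual by (intro inj_onI) (metis zero_neq_one)
  show "cfun.independent (f ` I)"
  proof (rule cfun.independent_if_scalars_zero)
    fix c g assume sum: "(\<Sum>g\<in>f ` I. scl (c g) g) = 0" and "g \<in> f ` I"
    then obtain j where j: "j \<in> I" "g = f j" by blast
    have "0 = (\<Sum>g\<in>f ` I. scl (c g) g) (x j)" by (simp add: sum)
    also have "\<dots> = (\<Sum>i\<in>I. c (f i) * f i (x j))"
      by (simp add: sum_fun_apply scl_apply sum.reindex[OF inj])
    also have "\<dots> = (\<Sum>i\<in>I. if i = j then c (f i) else 0)"
      using dual j(1) by (intro sum.cong) auto
    also have "\<dots> = c g" using I j by simp
    finally show "c g = 0" by simp
  qed (use I in simp)
qed

section \<open>Characters and Frobenius reciprocity\<close>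

definition linear_character :: "'g monoid \<Rightarrow> 'g set \<Rightarrow> ('g \<Rightarrow> complex) \<Rightarrow> bool" where
  "linear_character G H \<psi> \<longleftrightarrow>
     \<psi> \<one>\<^bsub>G\<^esub> = 1 \<and> (\<forall>h\<in>H. \<forall>k\<in>H. \<psi> (h \<otimes>\<^bsub>G\<^esub> k) = \<psi> h * \<psi> k)"

lemma linear_character_inv:
  assumes G: "group G" "subgroup H G" and \<psi>: "linear_character G H \<psi>" and h: "h \<in> H"
  shows "\<psi> h \<noteq> 0" "\<psi> (inv\<^bsub>G\<^esub> h) = inverse (\<psi> h)"
proof -
  have "inv\<^bsub>G\<^esub> h \<in> H" "h \<in> carrier G"
    using subgroup.m_inv_closed[OF G(2) h] subgroup.mem_carrier[OF G(2) h] by auto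
  then have "\<psi> h * \<psi> (inv\<^bsub>G\<^esub> h) = 1"
    using \<psi> h group.r_inv[OF G(1), of h] unfolding linear_character_def by metis
  then show "\<psi> h \<noteq> 0" "\<psi> (inv\<^bsub>G\<^esub> h) = inverse (\<psi> h)"
    by (auto simp: inverse_unique)
qed

lemma is_rep_basis:
  assumes "is_rep G (V, \<rho>)"
  obtains B where "basis_of B V"
proof -
  obtain A where "finite A" "V = cfun.span A" using assms by (auto simp: is_rep_def)
  then show ?thesis using extend_to_basis[of A V "{}"] that cfun.independent_empty by auto
qed

lemma rep_char_conjugate:
  fixes G (structure)
  assumes G: "group G" and rep: "is_rep G S" and g: "g \<in> carrier G" and h: "h \<in> carrier G"
  shows "rep_char S (g \<otimes> h \<otimes> inv g) = rep_char S h"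
proof -
  interpret group G by (rule G)
  obtain V \<rho> where S: "S = (V, \<rho>)" by force
  note rep = rep[unfolded S]
  have lin: "linear_map_on V V (\<rho> x)" if "x \<in> carrier G" for x
    using rep that by (auto simp: is_rep_def)
  have mem: "\<rho> x v \<in> V" if "x \<in> carrier G" "v \<in> V" for x v
    using lin[OF that(1)] that(2) by (auto simp: linear_map_on_def)
  have mult: "\<rho> (x \<otimes> y) v = \<rho> x (\<rho> y v)" if "x \<in> carrier G" "y \<in> carrier G" "v \<in> V" for x y v
    using rep that by (auto simp: is_rep_def)
  obtain B where B: "basis_of B V" using is_rep_basis[OF rep] .
  have "trace_on V (\<rho> (g \<otimes> h \<otimes> inv g)) = trace_on V (\<lambda>v. \<rho> (g \<otimes> h) (\<rho> (inv g) v))"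
    using g h by (intro trace_on_cong[OF B]) (auto simp: lin mult)
  also have "\<dots> = trace_on V (\<lambda>v. \<rho> (inv g) (\<rho> (g \<otimes> h) v))"
    using g h by (intro trace_on_commute[OF B] lin) auto
  also have "\<dots> = trace_on V (\<rho> h)"
  proof (rule trace_on_cong[OF B])
    show "linear_map_on V V (\<lambda>v. \<rho> (inv g) (\<rho> (g \<otimes> h) v))"
      using g h by (intro linear_map_on_comp[OF lin lin]) auto
    have "inv g \<otimes> (g \<otimes> h) = h"
      using g h m_assoc[of "inv g" g h] by simp
    then show "\<rho> (inv g) (\<rho> (g \<otimes> h) v) = \<rho> h v" if "v \<in> V" for v
      using g h mult[of "inv g" "g \<otimes> h" v] that by simp
  qed
  finally show ?thesis by (simp add: S rep_char_def)
qed

text \<open>An intertwiner \<open>F\<close> from \<open>S\<close> to the induced representation is determined by the functional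
  \<open>v \<mapsto> F v 1\<close>, because \<open>F v x = F (x\<^sup>-\<^sup>1 v) 1\<close>, and the functionals that occur are those on which
  \<open>H\<close> acts through \<open>\<psi>\<close>. These are the functionals that factor through the projection
  \<open>E = 1/|H| (\<Sum>h\<in>H. \<psi> (h)\<^sup>-\<^sup>1 h)\<close> onto the \<open>\<psi>\<close>-eigenspace, so the dimension in question is the trace
  of \<open>E\<close>, which is a sum of character values.\<close>

lemma frobenius_reciprocity_character:
  fixes G (structure)
  assumes G: "group G" and H: "subgroup H G" "finite H"
    and rep: "is_rep G S" and \<psi>: "linear_character G H \<psi>"
  shows "of_nat (card H) * of_int (rep_class G (Ind G H \<psi>) S) =
    (\<Sum>h\<in>H. inverse (\<psi> h) * rep_char S h)"
proof -
  interpret group G by (rule G)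
  interpret H: subgroup H G by (rule H)
  obtain V \<rho> where S: "S = (V, \<rho>)" by force
  note rep = rep[unfolded S]
  obtain A where A: "finite A" "V = cfun.span A" using rep by (auto simp: is_rep_def)
  have V: "cfun.subspace V" using A by simp
  have lin: "linear_map_on V V (\<rho> x)" if "x \<in> carrier G" for x
    using rep that by (auto simp: is_rep_def)
  have mem: "\<rho> x v \<in> V" if "x \<in> carrier G" "v \<in> V" for x v
    using lin[OF that(1)] that(2) by (auto simp: linear_map_on_def)
  have mult: "\<rho> (x \<otimes> y) v = \<rho> x (\<rho> y v)" if "x \<in> carrier G" "y \<in> carrier G" "v \<in> V" for x y v
    using rep that by (auto simp: is_rep_def)
  have one: "\<rho> \<one> v = v" if "v \<in> V" for v using rep that by (auto simp: is_rep_def)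
  have \<psi>_mult: "\<psi> (h \<otimes> k) = \<psi> h * \<psi> k" if "h \<in> H" "k \<in> H" for h k
    using \<psi> that by (simp add: linear_character_def)
  note \<psi>_nz = linear_character_inv(1)[OF G H(1) \<psi>]
    and \<psi>_inv = linear_character_inv(2)[OF G H(1) \<psi>]
  define n :: complex where "n = of_nat (card H)"
  have n: "n \<noteq> 0" using H(2) H.one_closed unfolding n_def by (metis card_0_eq empty_iff of_nat_eq_0_iff)

  define E where "E = (\<lambda>v. \<Sum>h\<in>H. scl (inverse (\<psi> h) / n) (\<rho> h v))"
  have linE: "linear_map_on V V E"
    unfolding E_def by (intro linear_map_on_sum V lin) auto
  have EV: "E v \<in> V" if "v \<in> V" for v using linE that by (auto simp: linear_map_on_def)
  have E_equiv: "E (\<rho> k v) = scl (\<psi> k) (E v)" if k: "k \<in> H" and v: "v \<in> V" for k v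
  proof -
    have "bij_betw (\<lambda>h. h \<otimes> k) H H"
      by (rule bij_betw_byWitness[where f' = "\<lambda>h. h \<otimes> inv k"])
         (use k in \<open>auto simp: m_assoc\<close>)
    then have "scl (\<psi> k) (E v) = scl (\<psi> k) (\<Sum>h\<in>H. scl (inverse (\<psi> (h \<otimes> k)) / n) (\<rho> (h \<otimes> k) v))"
      unfolding E_def by (simp add: sum.reindex_bij_betw[where g = "\<lambda>h. scl (inverse (\<psi> h) / n) (\<rho> h v)"])
    also have "\<dots> = E (\<rho> k v)"
      unfolding E_def cfun.scale_sum_right
      using k v \<psi>_nz by (intro sum.cong) (auto simp: mult \<psi>_mult field_simps)
    finally show ?thesis by simp
  qed
  \<comment> \<open>Used twice: for \<open>F = E\<close> it says that \<open>E\<close> is idempotent, and for the functional attached to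
    an intertwiner that it factors through \<open>E\<close>.\<close>
  have E_average: "F (E v) = F v"
    if F: "linear_map_on V W F" and v: "v \<in> V" and eq: "\<And>h. h \<in> H \<Longrightarrow> F (\<rho> h v) = scl (\<psi> h) (F v)"
    for F :: "(nat \<Rightarrow> complex) \<Rightarrow> 'c \<Rightarrow> complex" and W v
  proof -
    have "F (E v) = (\<Sum>h\<in>H. scl (inverse (\<psi> h) / n) (F (\<rho> h v)))"
      unfolding E_def using v by (intro linear_map_on_sum_scl[OF F V] mem) auto
    also have "\<dots> = (\<Sum>h\<in>H. scl (1 / n) (F v))"
      using \<psi>_nz by (intro sum.cong) (auto simp: eq)
    also have "\<dots> = F v"
      using n by (simp add: fun_eq_iff sum_fun_apply scl_apply n_def)
    finally show ?thesis .
  qed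
  have idem: "E (E v) = E v" if "v \<in> V" for v
    using E_average[OF linE that E_equiv] that by blast
  obtain B C where BC: "basis_of B V" "C \<subseteq> B" "\<And>b. b \<in> C \<Longrightarrow> E b = b"
    "\<And>v. v \<in> V \<Longrightarrow> E v \<in> cfun.span C" "trace_on V E = of_nat (card C)"
    using basis_adapted_to_idempotent[OF A linE idem] by metis
  have indB: "cfun.independent B" and spanB: "cfun.span B = V" and finC: "finite C"
    using BC by (auto simp: basis_of_def intro: finite_subset)
  have CV: "b \<in> V" if "b \<in> C" for b using that BC basis_of_subset by blast
  have trace: "n * trace_on V E = (\<Sum>h\<in>H. inverse (\<psi> h) * rep_char S h)"
    unfolding E_def using n
    by (simp add: trace_on_sum_scl[OF BC(1) lin] H.mem_carrier sum_distrib_left S rep_char_def)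

  \<comment> \<open>The intertwiners attached to the coordinate functionals \<open>v \<mapsto> (E v)\<^sub>b\<close> for \<open>b\<close> in the basis
    \<open>C\<close> of the eigenspace.\<close>
  define F where "F = (\<lambda>b v x. if v \<in> V \<and> x \<in> carrier G
      then cfun.representation B (E (\<rho> (inv x) v)) b else 0)"
  have add: "cfun.representation B (E (u + v)) b = cfun.representation B (E u) b + cfun.representation B (E v) b"
    if "u \<in> V" "v \<in> V" for u v b
    using linE that EV spanB indB by (simp add: linear_map_on_def cfun.representation_add)
  have scale: "cfun.representation B (E (scl c v)) b = c * cfun.representation B (E v) b"
    if "v \<in> V" for c v b
    using linE that EV spanB indB by (simp add: linear_map_on_def cfun.representation_scale)
  have lin_add: "\<rho> x (u + v) = \<rho> x u + \<rho> x v" and lin_scl: "\<rho> x (scl c v) = scl c (\<rho> x v)"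
    if "u \<in> V" "v \<in> V" "x \<in> carrier G" for x u v c
    using lin[OF that(3)] that by (auto simp: linear_map_on_def)
  have F_mem: "F b \<in> intertwiners G S (Ind G H \<psi>)" if "b \<in> C" for b
    unfolding intertwiners_def S Ind_def prod.case mem_Collect_eq
  proof (intro conjI ballI allI impI)
    show "linear_map_on V {f. (\<forall>x. x \<notin> carrier G \<longrightarrow> f x = 0) \<and>
        (\<forall>x\<in>carrier G. \<forall>h\<in>H. f (x \<otimes> h) = inverse (\<psi> h) * f x)} (F b)"
      unfolding linear_map_on_def
    proof (intro conjI ballI allI)
      show "F b \<in> V \<rightarrow> {f. (\<forall>x. x \<notin> carrier G \<longrightarrow> f x = 0) \<and>
        (\<forall>x\<in>carrier G. \<forall>h\<in>H. f (x \<otimes> h) = inverse (\<psi> h) * f x)}"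
        by (auto simp: F_def inv_mult_group mult E_equiv mem \<psi>_inv
            cfun.representation_scale[OF indB] spanB EV)
    next
      fix u v assume uv: "u \<in> V" "v \<in> V"
      then show "F b (u + v) = F b u + F b v"
        by (intro ext) (simp add: F_def cfun.subspace_add[OF V] lin_add mem add)
    next
      fix c v assume "v \<in> V"
      then show "F b (scl c v) = scl c (F b v)"
        by (intro ext) (simp add: F_def scl_apply cfun.subspace_scale[OF V] lin_scl mem scale)
    qed
  next
    fix v assume "v \<notin> V" then show "F b v = 0" by (auto simp: F_def fun_eq_iff)
  next
    fix g v assume "g \<in> carrier G" "v \<in> V"
    then show "F b (\<rho> g v) = (\<lambda>x. if x \<in> carrier G then F b v (inv g \<otimes> x) else 0)"
      by (auto simp: F_def fun_eq_iff inv_mult_group mult mem)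
  qed
  have dual: "case_prod (F b) (b', \<one>) = (if b = b' then 1 else 0)" if "b \<in> C" "b' \<in> C" for b b'
    using that BC(2,3) CV cfun.representation_basis[OF indB, of b']
    by (auto simp: F_def one)
  have expand: "case_prod K = (\<Sum>b\<in>C. scl (K b \<one>) (case_prod (F b)))"
    if K: "K \<in> intertwiners G S (Ind G H \<psi>)" for K
  proof -
    let ?I = "{f. (\<forall>x. x \<notin> carrier G \<longrightarrow> f x = 0) \<and>
        (\<forall>x\<in>carrier G. \<forall>h\<in>H. f (x \<otimes> h) = inverse (\<psi> h) * f x)}"
    have K_lin: "linear_map_on V ?I K" and K_out: "\<And>v. v \<notin> V \<Longrightarrow> K v = 0"
      and K_equiv: "\<And>g v. g \<in> carrier G \<Longrightarrow> v \<in> V \<Longrightarrow>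
        K (\<rho> g v) = (\<lambda>x. if x \<in> carrier G then K v (inv g \<otimes> x) else 0)"
      using K by (auto simp: intertwiners_def S Ind_def)
    have K_in: "K v \<in> ?I" if "v \<in> V" for v using K_lin that by (auto simp: linear_map_on_def)
    \<comment> \<open>The functional \<open>v \<mapsto> K v 1\<close>, with values in the functions on a one-point type, so that linear
      maps between function spaces apply to it.\<close>
    define L where "L = (\<lambda>v (_::unit). K v \<one>)"
    have L_lin: "linear_map_on V UNIV L"
      using K_lin by (auto simp: linear_map_on_def L_def fun_eq_iff scl_apply)
    have L_equiv: "L (\<rho> h v) = scl (\<psi> h) (L v)" if "h \<in> H" "v \<in> V" for h v
    proof -
      have "K (\<rho> h v) \<one> = K v (\<one> \<otimes> inv h)" using that by (simp add: K_equiv)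
      also have "\<dots> = inverse (\<psi> (inv h)) * K v \<one>"
        using K_in[OF that(2)] that(1) H.m_inv_closed[OF that(1)] by blast
      finally show ?thesis using that by (simp add: L_def scl_def \<psi>_inv)
    qed
    have eq: "K v x = (\<Sum>b\<in>C. K b \<one> * F b v x)" for v x
    proof (cases "v \<in> V \<and> x \<in> carrier G")
      case False
      then show ?thesis using K_out[of v] K_in[of v] by (cases "v \<in> V") (auto simp: F_def)
    next
      case True
      define w where "w = \<rho> (inv x) v"
      have w: "w \<in> V" using True by (simp add: w_def mem)
      have "K v x = L w ()" using True by (simp add: L_def w_def K_equiv)
      also have "L w = L (E w)" using E_average[OF L_lin w] L_equiv w by simp
      also have "E w = (\<Sum>b\<in>C. scl (cfun.representation B (E w) b) b)"
        using cfun.sum_representation_eq[OF _ BC(4)[OF w] finC order_refl]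
          cfun.independent_mono[OF indB BC(2)] cfun.representation_extend[OF indB BC(4)[OF w] BC(2)]
        by simp
      also have "L \<dots> () = (\<Sum>b\<in>C. cfun.representation B (E w) b * L b ())"
        using linear_map_on_sum_scl[OF L_lin V, of C "\<lambda>b. b"] CV by (simp add: sum_fun_apply scl_apply)
      finally show ?thesis using True by (simp add: F_def L_def w_def mult.commute)
    qed
    show ?thesis
    proof (rule ext)
      show "case_prod K z = (\<Sum>b\<in>C. scl (K b \<one>) (case_prod (F b))) z" for z
        using eq[of "fst z" "snd z"] by (simp only: sum_fun_apply scl_apply case_prod_beta)
    qed
  qed
  note indep = independent_dual_family[of C "\<lambda>b. case_prod (F b)" "\<lambda>b. (b, \<one>)", OF finC dual]
  have "cfun.dim (case_prod ` intertwiners G S (Ind G H \<psi>)) = card C"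
  proof (rule cfun.dim_unique[OF _ _ indep(2)])
    show "(\<lambda>b. case_prod (F b)) ` C \<subseteq> case_prod ` intertwiners G S (Ind G H \<psi>)"
      using F_mem by auto
    show "case_prod ` intertwiners G S (Ind G H \<psi>) \<subseteq> cfun.span ((\<lambda>b. case_prod (F b)) ` C)"
    proof (rule image_subsetI)
      fix K assume K: "K \<in> intertwiners G S (Ind G H \<psi>)"
      show "case_prod K \<in> cfun.span ((\<lambda>b. case_prod (F b)) ` C)"
        unfolding expand[OF K]
        by (intro cfun.span_sum cfun.span_scale cfun.span_base) (rule imageI)
    qed
    show "card ((\<lambda>b. case_prod (F b)) ` C) = card C" by (rule card_image[OF indep(1)])
  qed
  then show ?thesis
    using trace BC(5) by (simp add: rep_class_def n_def)
qed

section \<open>Character values in cyclotomic fields\<close>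

lemma complex_subfield_sum:
  assumes K: "complex_subfield K" and f: "\<And>i. i \<in> I \<Longrightarrow> f i \<in> K"
  shows "(\<Sum>i\<in>I. f i) \<in> K"
proof -
  have add: "x + y \<in> K" if "x \<in> K" "y \<in> K" for x y
  proof -
    have "x - (0 - y) \<in> K" using K that unfolding complex_subfield_def by blast
    then show ?thesis by simp
  qed
  have "0 \<in> K" using K by (simp add: complex_subfield_def)
  with f show ?thesis
    by (induction I rule: infinite_finite_induct) (auto intro: add)
qed

lemma complex_subfield_power: "complex_subfield K \<Longrightarrow> x \<in> K \<Longrightarrow> x ^ n \<in> K"
  by (induction n) (auto simp: complex_subfield_def)

lemma complex_subfield_of_nat: "complex_subfield K \<Longrightarrow> of_nat n \<in> K"
  using complex_subfield_sum[of K "{..<n}" "\<lambda>_. 1"] by (simp add: complex_subfield_def)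

lemma sum_powers_root_of_unity:
  fixes z :: complex
  assumes "z ^ n = 1" "z \<noteq> 1"
  shows "(\<Sum>l<n. z ^ l) = 0"
  using assms by (simp add: sum_gp_strict)

text \<open>The operator \<open>\<rho> h\<close> has order dividing \<open>p\<close>, so its trace is the sum of the \<open>\<zeta>\<^sup>l\<close> weighted with
  the dimensions \<open>m l\<close> of its eigenspaces. These are computed as traces of the eigenprojections
  \<open>E l = 1/p (\<Sum>j=1..p. \<zeta>\<^sup>-\<^sup>l\<^sup>j h\<^sup>j)\<close>, and finite Fourier inversion recovers the trace of \<open>\<rho> h\<close>.\<close>

lemma rep_char_in_cyclotomic_field:
  fixes G (structure)
  assumes G: "group G" and rep: "is_rep G S" and h: "h \<in> carrier G" "h [^] p = \<one>"
    and \<zeta>: "primitive_root_of_unity p \<zeta>" and K: "complex_subfield K" "\<zeta> \<in> K"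
  shows "rep_char S h \<in> K"
proof -
  interpret group G by (rule G)
  obtain V \<rho> where S: "S = (V, \<rho>)" by force
  note rep = rep[unfolded S]
  obtain A where A: "finite A" "V = cfun.span A" using rep by (auto simp: is_rep_def)
  have V: "cfun.subspace V" using A by simp
  have lin: "linear_map_on V V (\<rho> x)" if "x \<in> carrier G" for x
    using rep that by (auto simp: is_rep_def)
  have mem: "\<rho> x v \<in> V" if "x \<in> carrier G" "v \<in> V" for x v
    using lin[OF that(1)] that(2) by (auto simp: linear_map_on_def)
  have scl: "\<rho> x (scl c v) = scl c (\<rho> x v)" if "x \<in> carrier G" "v \<in> V" for x c v
    using lin[OF that(1)] that(2) by (auto simp: linear_map_on_def)
  have mult: "\<rho> (x \<otimes> y) v = \<rho> x (\<rho> y v)" if "x \<in> carrier G" "y \<in> carrier G" "v \<in> V" for x y v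
    using rep that by (auto simp: is_rep_def)
  have one: "\<rho> \<one> v = v" if "v \<in> V" for v using rep that by (auto simp: is_rep_def)
  obtain B where B: "basis_of B V" using is_rep_basis[OF rep] .
  have p: "p > 0" and \<zeta>p: "\<zeta> ^ p = 1" and prim: "\<And>k. 0 < k \<Longrightarrow> k < p \<Longrightarrow> \<zeta> ^ k \<noteq> 1"
    using \<zeta> by (auto simp: primitive_root_of_unity_def)
  have \<zeta>lp: "\<zeta> ^ (l * p) = 1" for l
    by (simp add: \<zeta>p power_mult mult.commute[of l])

  \<comment> \<open>The exponent \<open>l (p - j)\<close> replaces \<open>- l j\<close>, to which it is congruent modulo \<open>p\<close>. The index runs
    over \<open>1..p\<close> rather than \<open>0..p - 1\<close> so that \<open>j = 1\<close> occurs also for \<open>p = 1\<close>.\<close>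
  define E where "E l v = (\<Sum>j<p. scl (\<zeta> ^ (l * (p - Suc j)) / of_nat p) (\<rho> (h [^] Suc j) v))" for l v
  have linE: "linear_map_on V V (E l)" for l
    unfolding E_def using h by (intro linear_map_on_sum V lin) auto
  have EV: "E l v \<in> V" if "v \<in> V" for l v
    using linE that unfolding linear_map_on_def by blast
  have eigen: "\<rho> h (E l v) = scl (\<zeta> ^ l) (E l v)" if v: "v \<in> V" for l v
  proof -
    define f where "f j = scl (\<zeta> ^ (l * (p - j)) / of_nat p) (\<rho> (h [^] j) v)" for j
    have "f 0 = f p" by (simp add: f_def h \<zeta>lp)
    then have shift: "(\<Sum>j<p. f j) = (\<Sum>j<p. f (Suc j))"
      using sum.lessThan_Suc_shift[of f p] by simp
    have step: "\<rho> h (f j) = scl (\<zeta> ^ l) (f (Suc j))" if "j < p" for j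
    proof -
      have "l * (p - j) = l + l * (p - Suc j)"
        using that by (metis Suc_diff_Suc add.commute mult_Suc_right)
      moreover have "h [^] Suc j = h \<otimes> h [^] j" using h nat_pow_Suc2[of h j] by simp
      ultimately show ?thesis
        using h v by (simp add: f_def scl mem mult[symmetric] power_add del: nat_pow_Suc)
    qed
    have "\<rho> h (E l v) = \<rho> h (\<Sum>j<p. scl 1 (f j))"
      unfolding E_def using shift by (simp add: f_def)
    also have "\<dots> = (\<Sum>j<p. scl 1 (\<rho> h (f j)))"
      using h v by (intro linear_map_on_sum_scl[OF lin V])
        (auto simp: f_def intro!: cfun.subspace_scale[OF V] mem)
    also have "\<dots> = scl (\<zeta> ^ l) (\<Sum>j<p. f (Suc j))"
      by (simp add: step cfun.scale_sum_right)
    finally show ?thesis by (simp add: E_def f_def)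
  qed
  have eigen_pow: "\<rho> (h [^] j) (E l v) = scl (\<zeta> ^ (l * j)) (E l v)" if v: "v \<in> V" for j l v
  proof (induction j)
    case 0
    then show ?case using EV[OF v] by (simp add: one)
  next
    case (Suc j)
    have "\<rho> (h [^] Suc j) (E l v) = \<rho> (h [^] j) (\<rho> h (E l v))"
      using h EV[OF v] by (simp add: mult)
    then show ?case using Suc h EV[OF v] by (simp add: eigen[OF v] scl power_add)
  qed
  have idem: "E l (E l v) = E l v" if v: "v \<in> V" for l v
  proof -
    have inverse: "\<zeta> ^ (l * (p - Suc j)) * \<zeta> ^ (l * Suc j) = 1" if "j < p" for j
    proof -
      have "l * (p - Suc j) + l * Suc j = l * p"
        using that by (metis Suc_leI add.commute distrib_left le_add_diff_inverse)
      then show ?thesis by (metis \<zeta>lp power_add)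
    qed
    have "E l (E l v) = (\<Sum>j<p. scl (1 / of_nat p) (E l v))"
      unfolding E_def[of l "E l v"]
    proof (intro sum.cong refl)
      fix j assume "j \<in> {..<p}"
      then show "scl (\<zeta> ^ (l * (p - Suc j)) / of_nat p) (\<rho> (h [^] Suc j) (E l v)) =
          scl (1 / of_nat p) (E l v)"
        unfolding eigen_pow[OF v] cfun.scale_scale times_divide_eq_left
        by (simp only: lessThan_iff inverse)
    qed
    also have "\<dots> = E l v" using p by (simp add: fun_eq_iff sum_fun_apply scl_apply)
    finally show ?thesis .
  qed
  have "\<exists>m. trace_on V (E l) = of_nat m" for l
    using basis_adapted_to_idempotent[OF A linE idem] by metis
  then obtain m where m: "\<And>l. trace_on V (E l) = of_nat (m l)" by metis

  have m_eq: "of_nat (m l) =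
      (\<Sum>j<p. \<zeta> ^ (l * (p - Suc j)) / of_nat p * rep_char S (h [^] Suc j))" for l
  proof -
    have "trace_on V (E l) = (\<Sum>j<p. \<zeta> ^ (l * (p - Suc j)) / of_nat p * trace_on V (\<rho> (h [^] Suc j)))"
      unfolding E_def[abs_def] by (rule trace_on_sum_scl[OF B lin]) (rule nat_pow_closed[OF h(1)])
    then show ?thesis by (simp only: m S rep_char_def prod.case)
  qed
  have "of_nat p * (\<Sum>l<p. \<zeta> ^ l * of_nat (m l)) =
      of_nat p * (\<Sum>l<p. \<zeta> ^ l * (\<Sum>j<p. \<zeta> ^ (l * (p - Suc j)) / of_nat p * rep_char S (h [^] Suc j)))"
    by (simp only: m_eq)
  also have "\<dots> = (\<Sum>l<p. \<Sum>j<p. \<zeta> ^ (l + l * (p - Suc j)) * rep_char S (h [^] Suc j))"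
    using p by (simp add: sum_distrib_left power_add mult.assoc del: nat_pow_Suc)
  also have "\<dots> = (\<Sum>l<p. \<Sum>j<p. (\<zeta> ^ (p - j)) ^ l * rep_char S (h [^] Suc j))"
  proof (intro sum.cong refl)
    fix l j assume "j \<in> {..<p}"
    then have "l + l * (p - Suc j) = (p - j) * l"
      by (metis Suc_diff_Suc lessThan_iff mult.commute mult_Suc_right)
    then show "\<zeta> ^ (l + l * (p - Suc j)) * rep_char S (h [^] Suc j)
        = (\<zeta> ^ (p - j)) ^ l * rep_char S (h [^] Suc j)"
      by (simp only: power_mult)
  qed
  also have "\<dots> = (\<Sum>j<p. (\<Sum>l<p. (\<zeta> ^ (p - j)) ^ l) * rep_char S (h [^] Suc j))"
    by (subst sum.swap) (simp add: sum_distrib_right del: nat_pow_Suc)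
  \<comment> \<open>By orthogonality only the term of \<open>h\<^sup>1\<close> survives.\<close>
  also have "\<dots> = (\<Sum>j<p. if j = 0 then of_nat p * rep_char S h else 0)"
  proof (intro sum.cong refl)
    fix j assume j: "j \<in> {..<p}"
    have "(\<Sum>l<p. (\<zeta> ^ (p - j)) ^ l) = 0" if "j \<noteq> 0"
      using that j prim[of "p - j"]
      by (intro sum_powers_root_of_unity) (auto simp: power_mult[symmetric] \<zeta>lp)
    then show "(\<Sum>l<p. (\<zeta> ^ (p - j)) ^ l) * rep_char S (h [^] Suc j) =
        (if j = 0 then of_nat p * rep_char S h else 0)"
      using h by (simp add: \<zeta>p)
  qed
  also have "\<dots> = of_nat p * rep_char S h" using p by simp
  finally have "rep_char S h = (\<Sum>l<p. \<zeta> ^ l * of_nat (m l))" using p by simp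
  moreover have "\<zeta> ^ l * of_nat (m l) \<in> K" for l
    using complex_subfield_power[OF K] complex_subfield_of_nat[OF K(1)] K(1)
    by (simp add: complex_subfield_def)
  ultimately show ?thesis by (simp only: complex_subfield_sum[OF K(1)])
qed

section \<open>Regular functions and morphisms\<close>

lemma topspace_zariski [simp]: "topspace (zariski :: 'n::finite proj topology) = UNIV"
proof -
  have "0 \<in> line P" for P :: "'n proj"
  proof -
    obtain v where "line P = range (\<lambda>c. c *s v)" using line[of P] by blast
    then show ?thesis by (metis rangeI vector_smult_lzero)
  qed
  then have "zeros {\<lambda>x. 1} = ({} :: 'n proj set)"
    unfolding zeros_def by auto
  moreover have "form 0 (\<lambda>x :: complex^'n. 1)" by (rule form.const)
  ultimately have "zariski_closed ({} :: 'n proj set)"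
    unfolding zariski_closed_def by (intro exI[of _ "{\<lambda>x. 1}"]) auto
  then have "openin zariski (UNIV :: 'n proj set)" by (simp add: openin_zariski)
  then show ?thesis using openin_subset by blast
qed

lemma regular_atE:
  assumes "regular_at X P f"
  obtains U d p q where "openin (subtopology zariski X) U" "P \<in> U" "form d p" "form d q"
    "\<And>Q x. Q \<in> U \<Longrightarrow> x \<in> line Q \<Longrightarrow> x \<noteq> 0 \<Longrightarrow> q x \<noteq> 0 \<and> f Q = p x / q x"
proof -
  from assms obtain U d p q where "openin (subtopology zariski X) U" "P \<in> U" "form d p" "form d q"
    and "\<forall>Q\<in>U. \<forall>x\<in>line Q. x \<noteq> 0 \<longrightarrow> q x \<noteq> 0 \<and> f Q = p x / q x"
    unfolding regular_at_def by (elim exE conjE)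
  then show ?thesis by (intro that[of U d p q]) simp_all
qed

lemma regular_atI:
  assumes "openin (subtopology zariski X) U" "P \<in> U" "form d p" "form d q"
    "\<And>Q x. Q \<in> U \<Longrightarrow> x \<in> line Q \<Longrightarrow> x \<noteq> 0 \<Longrightarrow> q x \<noteq> 0 \<and> f Q = p x / q x"
  shows "regular_at X P f"
  unfolding regular_at_def using assms
  by (intro exI[of _ U] exI[of _ d] exI[of _ p] exI[of _ q] conjI ballI impI) simp_all

lemma regular_at_cong:
  assumes f: "regular_at X P f" and eq: "\<And>Q. Q \<in> X \<Longrightarrow> f Q = g Q"
  shows "regular_at X P g"
proof -
  from f obtain U d p q where U: "openin (subtopology zariski X) U" "P \<in> U" "form d p" "form d q"
    "\<And>Q x. Q \<in> U \<Longrightarrow> x \<in> line Q \<Longrightarrow> x \<noteq> 0 \<Longrightarrow> q x \<noteq> 0 \<and> f Q = p x / q x"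
    by (rule regular_atE) (rule that)
  have UX: "U \<subseteq> X" using U(1) by (rule openin_imp_subset)
  show ?thesis
  proof (rule regular_atI[OF U(1-4)])
    fix Q x assume Q: "Q \<in> U" "x \<in> line Q" "x \<noteq> 0"
    then have "g Q = f Q" using eq[of Q] UX by auto
    then show "q x \<noteq> 0 \<and> g Q = p x / q x" using U(5)[OF Q] by simp
  qed
qed

lemma regular_at_scale:
  assumes f: "regular_at X P f"
  shows "regular_at X P (\<lambda>Q. c * f Q)"
proof -
  from f obtain U d p q where U: "openin (subtopology zariski X) U" "P \<in> U" "form d p" "form d q"
    "\<And>Q x. Q \<in> U \<Longrightarrow> x \<in> line Q \<Longrightarrow> x \<noteq> 0 \<Longrightarrow> q x \<noteq> 0 \<and> f Q = p x / q x"
    by (rule regular_atE) (rule that)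
  have "form (0 + d) (\<lambda>x. c * p x)" by (intro form.mult form.const U(3))
  then have "form d (\<lambda>x. c * p x)" by simp
  from regular_atI[OF U(1,2) this U(4)] show ?thesis using U(5) by simp
qed

lemma morphism_regular_at:
  "morphism X Y f \<Longrightarrow> P \<in> X \<Longrightarrow> regular_at Y (f P) h \<Longrightarrow> regular_at X P (h \<circ> f)"
  unfolding morphism_def by (drule conjunct2, drule (1) bspec, drule spec, drule (1) mp)

lemma morphism_continuous:
  "morphism X Y f \<Longrightarrow> continuous_map (subtopology zariski X) (subtopology zariski Y) f"
  unfolding morphism_def by (rule conjunct1)

lemma morphism_cong:
  assumes f: "morphism X Y f" and eq: "\<And>P. P \<in> X \<Longrightarrow> f P = g P"
  shows "morphism X Y g"
  unfolding morphism_def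
proof (intro conjI ballI allI impI)
  show "continuous_map (subtopology zariski X) (subtopology zariski Y) g"
    by (rule continuous_map_eq[OF morphism_continuous[OF f]]) (simp add: eq)
next
  fix P h assume P: "P \<in> X" and h: "regular_at Y (g P) h"
  then have "regular_at X P (h \<circ> f)" using morphism_regular_at[OF f P, of h] by (simp only: eq[OF P])
  then show "regular_at X P (h \<circ> g)" by (rule regular_at_cong) (simp add: eq)
qed

lemma morphism_id: "morphism X X id"
  by (simp add: morphism_def)

lemma morphism_compose:
  assumes f: "morphism X Y f" "f \<in> X \<rightarrow> Y" and g: "morphism Y Z g"
  shows "morphism X Z (g \<circ> f)"
  unfolding morphism_def
proof (intro conjI ballI allI impI)
  show "continuous_map (subtopology zariski X) (subtopology zariski Z) (g \<circ> f)"
    by (rule continuous_map_compose[OF morphism_continuous[OF f(1)] morphism_continuous[OF g]])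
next
  fix P h assume P: "P \<in> X" and h: "regular_at Z ((g \<circ> f) P) h"
  have "f P \<in> Y" using f(2) P by blast
  then have "regular_at Y (f P) (h \<circ> g)"
    by (rule morphism_regular_at[OF g]) (use h in \<open>simp only: comp_apply\<close>)
  from morphism_regular_at[OF f(1) P this]
  show "regular_at X P (h \<circ> (g \<circ> f))" by (simp only: o_assoc)
qed

section \<open>Automorphism groups and stabilizers\<close>

text \<open>The group operations of \<open>BijGroup X\<close> return functions that are undefined outside \<open>X\<close>, while
  \<open>inv_into\<close> and composition are not restricted; being a morphism depends on the values on \<open>X\<close> only,
  so \<open>morphism_cong\<close> passes between the two.\<close>

lemma subgroup_automorphisms:
  "subgroup {\<phi> \<in> Bij X. morphism X X \<phi> \<and> morphism X X (inv_into X \<phi>)} (BijGroup X)"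
proof (rule group.subgroupI[OF group_BijGroup])
  let ?A = "{\<phi> \<in> Bij X. morphism X X \<phi> \<and> morphism X X (inv_into X \<phi>)}"
  show "?A \<subseteq> carrier (BijGroup X)" by (auto simp: BijGroup_def)
  have "morphism X X (\<lambda>P\<in>X. P)" by (rule morphism_cong[OF morphism_id]) simp
  moreover have "morphism X X (inv_into X (\<lambda>P\<in>X. P))"
    by (rule morphism_cong[OF morphism_id])
       (auto intro!: inv_into_f_eq[symmetric] simp: inj_on_def)
  ultimately have "(\<lambda>P\<in>X. P) \<in> ?A" using id_Bij by blast
  then show "?A \<noteq> {}" by blast
next
  fix \<phi> assume \<phi>: "\<phi> \<in> {\<phi> \<in> Bij X. morphism X X \<phi> \<and> morphism X X (inv_into X \<phi>)}"
  then have bij: "bij_betw \<phi> X X" by (auto simp: Bij_def)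
  have "morphism X X (\<lambda>P\<in>X. inv_into X \<phi> P)" by (rule morphism_cong) (use \<phi> in auto)
  moreover have "morphism X X (inv_into X (\<lambda>P\<in>X. inv_into X \<phi> P))"
  proof (rule morphism_cong)
    show "morphism X X \<phi>" using \<phi> by blast
    fix P assume P: "P \<in> X"
    have "inj_on (\<lambda>P\<in>X. inv_into X \<phi> P) X"
      using bij_betw_inv_into[OF bij] by (simp add: bij_betw_def inj_on_def)
    moreover have "\<phi> P \<in> X" "inv_into X \<phi> (\<phi> P) = P"
      using bij P by (auto simp: bij_betw_def)
    ultimately show "\<phi> P = inv_into X (\<lambda>P\<in>X. inv_into X \<phi> P) P"
      by (intro inv_into_f_eq[symmetric]) auto
  qed
  ultimately show "inv\<^bsub>BijGroup X\<^esub> \<phi> \<in> {\<phi> \<in> Bij X. morphism X X \<phi> \<and> morphism X X (inv_into X \<phi>)}"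
    using \<phi> by (simp add: inv_BijGroup restrict_inv_into_Bij)
next
  fix \<phi> \<psi> assume \<phi>: "\<phi> \<in> {\<phi> \<in> Bij X. morphism X X \<phi> \<and> morphism X X (inv_into X \<phi>)}"
    and \<psi>: "\<psi> \<in> {\<phi> \<in> Bij X. morphism X X \<phi> \<and> morphism X X (inv_into X \<phi>)}"
  then have bij: "bij_betw \<phi> X X" "bij_betw \<psi> X X" by (auto simp: Bij_def)
  have "morphism X X (compose X \<phi> \<psi>)"
    by (rule morphism_cong[OF morphism_compose[of X X \<psi> X \<phi>]])
       (use \<phi> \<psi> Bij_imp_funcset in \<open>auto simp: compose_def\<close>)
  moreover have "morphism X X (inv_into X (compose X \<phi> \<psi>))"
  proof (rule morphism_cong[OF morphism_compose[of X X "inv_into X \<phi>" X "inv_into X \<psi>"]])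
    show "inv_into X \<phi> \<in> X \<rightarrow> X" using bij_betw_inv_into[OF bij(1)] by (auto simp: bij_betw_def)
    fix P assume P: "P \<in> X"
    have mem: "inv_into X \<phi> P \<in> X" "inv_into X \<psi> (inv_into X \<phi> P) \<in> X"
      using bij P by (auto simp: bij_betw_def inv_into_into)
    have "inj_on (compose X \<phi> \<psi>) X" using bij_betw_compose[OF bij(2,1)] by (simp add: bij_betw_def)
    moreover have "compose X \<phi> \<psi> (inv_into X \<psi> (inv_into X \<phi> P)) = P"
      using mem bij P by (simp add: compose_def bij_betw_def f_inv_into_f)
    ultimately show "(inv_into X \<psi> \<circ> inv_into X \<phi>) P = inv_into X (compose X \<phi> \<psi>) P"
      using mem by (simp add: inv_into_f_eq)
  qed (use \<phi> \<psi> in auto)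
  ultimately show "\<phi> \<otimes>\<^bsub>BijGroup X\<^esub> \<psi> \<in> {\<phi> \<in> Bij X. morphism X X \<phi> \<and> morphism X X (inv_into X \<phi>)}"
    using \<phi> \<psi> by (simp add: BijGroup_def compose_Bij)
qed

lemma group_aut_group: "group (aut_group X)"
  unfolding aut_group_def
  by (rule subgroup.subgroup_is_group[OF subgroup_automorphisms group_BijGroup])

lemma aut_group_simps:
  "g \<in> carrier (aut_group X) \<longleftrightarrow> g \<in> Bij X \<and> morphism X X g \<and> morphism X X (inv_into X g)"
  "\<one>\<^bsub>aut_group X\<^esub> = (\<lambda>P\<in>X. P)"
  by (simp_all add: aut_group_def BijGroup_def)

lemma aut_group_closed: "g \<in> carrier (aut_group X) \<Longrightarrow> P \<in> X \<Longrightarrow> g P \<in> X"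
  using Bij_imp_funcset by (auto simp: aut_group_simps)

lemma aut_group_mult:
  "g \<in> carrier (aut_group X) \<Longrightarrow> h \<in> carrier (aut_group X) \<Longrightarrow> P \<in> X \<Longrightarrow>
    (g \<otimes>\<^bsub>aut_group X\<^esub> h) P = g (h P)"
  by (simp add: aut_group_simps(1)) (simp add: aut_group_def BijGroup_def compose_def)

lemma aut_group_inv_cancel:
  assumes "g \<in> carrier (aut_group X)" "P \<in> X"
  shows "(inv\<^bsub>aut_group X\<^esub> g) (g P) = P"
proof -
  interpret group "aut_group X" by (rule group_aut_group)
  have "(inv\<^bsub>aut_group X\<^esub> g) (g P) = (inv\<^bsub>aut_group X\<^esub> g \<otimes>\<^bsub>aut_group X\<^esub> g) P"
    by (rule aut_group_mult[symmetric]) (use assms in auto)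
  also have "\<dots> = P" using assms by (simp add: aut_group_simps(2))
  finally show ?thesis .
qed

lemma subgroup_stab:
  assumes P: "P \<in> X"
  shows "subgroup (stab X P) (aut_group X)"
proof -
  interpret group "aut_group X" by (rule group_aut_group)
  show ?thesis
  proof (rule subgroupI)
    have "\<one>\<^bsub>aut_group X\<^esub> \<in> stab X P" 
      using P by (simp add: stabilizer_def aut_group_simps(2) del: one_closed)
        (use one_closed in \<open>simp add: aut_group_simps(2)\<close>)
    then show "stab X P \<noteq> {}" by blast
  next
    fix g assume g: "g \<in> stab X P"
    then have "(inv\<^bsub>aut_group X\<^esub> g) P = P"
      using aut_group_inv_cancel[of g X P] P by (simp add: stabilizer_def)
    then show "inv\<^bsub>aut_group X\<^esub> g \<in> stab X P" using g by (simp add: stabilizer_def)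
  qed (auto simp: stabilizer_def aut_group_mult P)
qed

lemma card_stab_orbit:
  assumes P: "P \<in> X" and Q: "Q \<in> orbit (aut_group X) (\<lambda>g. g) P" and triv: "card (stab X P) = 1"
  shows "card (stab X Q) = 1"
proof -
  interpret group "aut_group X" by (rule group_aut_group)
  obtain g where g: "g \<in> carrier (aut_group X)" "Q = g P" 
    using Q unfolding orbit_def by blast
  have QX: "Q \<in> X" using g P by (simp add: aut_group_closed)
  have one: "h = \<one>\<^bsub>aut_group X\<^esub>" if "h \<in> stab X P" for h
    using that triv subgroup.one_closed[OF subgroup_stab[OF P]] by (metis card_1_singletonE singletonD)
  have "h = \<one>\<^bsub>aut_group X\<^esub>" if h: "h \<in> stab X Q" for h
  proof -
    have hc: "h \<in> carrier (aut_group X)" and "h Q = Q" using h by (auto simp: stabilizer_def)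
    then have "(inv\<^bsub>aut_group X\<^esub> g \<otimes>\<^bsub>aut_group X\<^esub> (h \<otimes>\<^bsub>aut_group X\<^esub> g)) P = P"
      using g P QX by (simp add: aut_group_mult aut_group_inv_cancel)
    then have "inv\<^bsub>aut_group X\<^esub> g \<otimes>\<^bsub>aut_group X\<^esub> (h \<otimes>\<^bsub>aut_group X\<^esub> g) = \<one>\<^bsub>aut_group X\<^esub>"
      using g hc by (intro one) (simp add: stabilizer_def)
    then have "h \<otimes>\<^bsub>aut_group X\<^esub> g = g" using g hc by (metis inv_solve_left m_closed one_closed r_one)
    then show ?thesis using g hc by (metis l_one one_closed right_cancel)
  qed
  then have "stab X Q = {\<one>\<^bsub>aut_group X\<^esub>}"
    using subgroup.one_closed[OF subgroup_stab[OF QX]] by blast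
  then show ?thesis by simp
qed

section \<open>The ramification character\<close>

lemma max_ideal_scale: "f \<in> max_ideal X P \<Longrightarrow> (\<lambda>Q. c * f Q) \<in> max_ideal X P"
  by (simp add: max_ideal_def regular_at_scale)

lemma max_ideal_sq_cong:
  assumes "f \<in> max_ideal_sq X P" "\<And>Q. Q \<in> X \<Longrightarrow> f Q = g Q"
  shows "g \<in> max_ideal_sq X P"
proof -
  obtain U k a b where U: "openin (subtopology zariski X) U" "P \<in> U"
    "\<And>i. i < k \<Longrightarrow> a i \<in> max_ideal X P \<and> b i \<in> max_ideal X P"
    "\<And>Q. Q \<in> U \<Longrightarrow> f Q = (\<Sum>i<(k::nat). a i Q * b i Q)"
    using assms(1) unfolding max_ideal_sq_def by blast
  have "U \<subseteq> X" using U(1) by (rule openin_imp_subset)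
  then have "g Q = (\<Sum>i<k. a i Q * b i Q)" if "Q \<in> U" for Q
    using U(4)[OF that] assms(2)[of Q] that by auto
  then show ?thesis using U(1-3) unfolding max_ideal_sq_def by blast
qed

lemma max_ideal_sq_zero:
  assumes "P \<in> X" "\<And>Q. Q \<in> X \<Longrightarrow> f Q = 0"
  shows "f \<in> max_ideal_sq X P"
proof -
  have "openin (subtopology zariski X) X" using openin_topspace[of "subtopology zariski X"] by simp
  then show ?thesis
    using assms unfolding max_ideal_sq_def mem_Collect_eq
    by (intro exI[of _ X] exI[of _ "0::nat"]) simp
qed

lemma sum_lessThan_add: "(\<Sum>i<m + n. f i) = (\<Sum>i<m. f i) + (\<Sum>i<n. f (m + i))"
  for f :: "nat \<Rightarrow> 'a::comm_monoid_add"
  by (induction n) (auto simp: add_ac)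

lemma max_ideal_sq_add:
  assumes "f \<in> max_ideal_sq X P" "g \<in> max_ideal_sq X P"
  shows "(\<lambda>Q. f Q + g Q) \<in> max_ideal_sq X P"
proof -
  obtain U k a b where U: "openin (subtopology zariski X) U" "P \<in> U"
    "\<And>i. i < k \<Longrightarrow> a i \<in> max_ideal X P \<and> b i \<in> max_ideal X P"
    "\<And>Q. Q \<in> U \<Longrightarrow> f Q = (\<Sum>i<(k::nat). a i Q * b i Q)"
    using assms(1) unfolding max_ideal_sq_def by blast
  obtain U' k' a' b' where U': "openin (subtopology zariski X) U'" "P \<in> U'"
    "\<And>i. i < k' \<Longrightarrow> a' i \<in> max_ideal X P \<and> b' i \<in> max_ideal X P"
    "\<And>Q. Q \<in> U' \<Longrightarrow> g Q = (\<Sum>i<(k'::nat). a' i Q * b' i Q)"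
    using assms(2) unfolding max_ideal_sq_def by blast
  let ?a = "\<lambda>i. if i < k then a i else a' (i - k)"
  let ?b = "\<lambda>i. if i < k then b i else b' (i - k)"
  have "openin (subtopology zariski X) (U \<inter> U')" using U(1) U'(1) by (rule openin_Int)
  moreover have "\<forall>i<k + k'. ?a i \<in> max_ideal X P \<and> ?b i \<in> max_ideal X P"
    using U(3) U'(3) by auto
  moreover have "\<forall>Q\<in>U \<inter> U'. f Q + g Q = (\<Sum>i<k + k'. ?a i Q * ?b i Q)"
    using U(4) U'(4) by (simp add: sum_lessThan_add)
  ultimately show ?thesis
    unfolding max_ideal_sq_def mem_Collect_eq using U(2) U'(2)
    by (intro exI[of _ "U \<inter> U'"] exI[of _ "k + k'"] exI[of _ ?a] exI[of _ ?b]) blast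
qed

lemma max_ideal_sq_scale:
  assumes "f \<in> max_ideal_sq X P"
  shows "(\<lambda>Q. c * f Q) \<in> max_ideal_sq X P"
proof -
  obtain U k a b where U: "openin (subtopology zariski X) U" "P \<in> U"
    "\<And>i. i < k \<Longrightarrow> a i \<in> max_ideal X P \<and> b i \<in> max_ideal X P"
    "\<And>Q. Q \<in> U \<Longrightarrow> f Q = (\<Sum>i<(k::nat). a i Q * b i Q)"
    using assms(1) unfolding max_ideal_sq_def by blast
  have "\<forall>i<k. (\<lambda>Q. c * a i Q) \<in> max_ideal X P \<and> b i \<in> max_ideal X P"
    using U(3) max_ideal_scale by blast
  moreover have "\<forall>Q\<in>U. c * f Q = (\<Sum>i<k. c * a i Q * b i Q)"
    using U(4) by (simp add: sum_distrib_left mult.assoc)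
  ultimately show ?thesis
    unfolding max_ideal_sq_def mem_Collect_eq using U(1,2)
    by (intro exI[of _ U] exI[of _ k] exI[of _ "\<lambda>i Q. c * a i Q"] exI[of _ b]) blast
qed

lemma max_ideal_pullback:
  assumes P: "P \<in> X" and \<phi>: "morphism X X \<phi>" "\<phi> P = P"
  shows "f \<in> max_ideal X P \<Longrightarrow> f \<circ> \<phi> \<in> max_ideal X P"
    and "f \<in> max_ideal_sq X P \<Longrightarrow> f \<circ> \<phi> \<in> max_ideal_sq X P"
proof -
  show pull: "f \<circ> \<phi> \<in> max_ideal X P" if "f \<in> max_ideal X P" for f
    using that morphism_regular_at[OF \<phi>(1) P, of f] \<phi>(2) by (simp add: max_ideal_def)
  assume "f \<in> max_ideal_sq X P"
  then obtain U k a b where U: "openin (subtopology zariski X) U" "P \<in> U"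
    "\<And>i. i < k \<Longrightarrow> a i \<in> max_ideal X P \<and> b i \<in> max_ideal X P"
    "\<And>Q. Q \<in> U \<Longrightarrow> f Q = (\<Sum>i<(k::nat). a i Q * b i Q)"
    unfolding max_ideal_sq_def by blast
  let ?U = "{Q \<in> X. \<phi> Q \<in> U}"
  have "openin (subtopology zariski X) ?U"
    using openin_continuous_map_preimage[OF morphism_continuous[OF \<phi>(1)] U(1)] by simp
  moreover have "P \<in> ?U" using P U(2) \<phi>(2) by simp
  moreover have "\<forall>i<k. a i \<circ> \<phi> \<in> max_ideal X P \<and> b i \<circ> \<phi> \<in> max_ideal X P"
    using U(3) pull by blast
  moreover have "\<forall>Q\<in>?U. (f \<circ> \<phi>) Q = (\<Sum>i<k. (a i \<circ> \<phi>) Q * (b i \<circ> \<phi>) Q)"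
    using U(4) by simp
  ultimately show "f \<circ> \<phi> \<in> max_ideal_sq X P"
    unfolding max_ideal_sq_def mem_Collect_eq
    by (intro exI[of _ ?U] exI[of _ k] exI[of _ "\<lambda>i. a i \<circ> \<phi>"] exI[of _ "\<lambda>i. b i \<circ> \<phi>"]) blast
qed

text \<open>A coefficient function on a one-element basis is a single scalar.\<close>

lemma quot_dim_one:
  assumes "quot_dim V W 1"
  obtains b where "b \<in> V" "\<And>v. v \<in> V \<Longrightarrow> \<exists>!a. v - scl a b \<in> W"
proof -
  from assms obtain B where B: "B \<subseteq> V" "card B = 1"
    and unique: "\<forall>v\<in>V. \<exists>!c. c \<in> B \<rightarrow>\<^sub>E (UNIV :: complex set) \<and> v - (\<Sum>b\<in>B. scl (c b) b) \<in> W"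
    unfolding quot_dim_def by (elim exE conjE)
  obtain b where b: "B = {b}" using B(2) by (rule card_1_singletonE)
  have "\<exists>!a. v - scl a b \<in> W" if v: "v \<in> V" for v
  proof (rule ex_ex1I)
    show "\<exists>a. v - scl a b \<in> W" using bspec[OF unique v] unfolding b by auto
  next
    fix a a' assume a: "v - scl a b \<in> W" "v - scl a' b \<in> W"
    have const: "(\<lambda>x\<in>{b}. d) \<in> B \<rightarrow>\<^sub>E UNIV \<and> v - (\<Sum>x\<in>B. scl ((\<lambda>x\<in>{b}. d) x) x) \<in> W"
      if "v - scl d b \<in> W" for d using that by (simp add: b)
    have "(\<lambda>x\<in>{b}. a) = (\<lambda>x\<in>{b}. a')"
      using bspec[OF unique v] const[OF a(1)] const[OF a(2)] by (elim ex1E) metis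
    then have "(\<lambda>x\<in>{b}. a) b = (\<lambda>x\<in>{b}. a') b" by (rule arg_cong)
    then show "a = a'" by simp
  qed
  then show ?thesis using that B(1) b by blast
qed

text \<open>The scalars \<open>c\<close> by which \<open>g\<close> may act on the cotangent space at \<open>P\<close>: the property that the
  definition of \<open>ram_char\<close> singles out.\<close>

definition acts_by :: "'n::finite proj set \<Rightarrow> 'n proj \<Rightarrow> ('n proj \<Rightarrow> 'n proj) \<Rightarrow> complex \<Rightarrow> bool" where
  "acts_by X P g c \<longleftrightarrow> (\<forall>f\<in>max_ideal X P.
     (\<lambda>Q. f ((inv\<^bsub>aut_group X\<^esub> g) Q) - c * f Q) \<in> max_ideal_sq X P)"

text \<open>An endomorphism of a one-dimensional space is multiplication by a unique scalar; the space is the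
  cotangent space, spanned by the class of \<open>b\<close>.\<close>

lemma acts_by_exists_unique:
  assumes X: "smooth_projective_curve X" and P: "P \<in> X" and g: "g \<in> stab X P"
  shows "\<exists>!c. acts_by X P g c"
proof -
  let ?i = "inv\<^bsub>aut_group X\<^esub> g"
  have "?i \<in> stab X P" by (rule subgroup.m_inv_closed[OF subgroup_stab[OF P] g])
  then have i: "morphism X X ?i" "?i P = P" by (auto simp: stabilizer_def aut_group_simps(1))
  obtain b where b: "b \<in> max_ideal X P"
    "\<And>v. v \<in> max_ideal X P \<Longrightarrow> \<exists>!a. v - scl a b \<in> max_ideal_sq X P"
    using X P quot_dim_one unfolding smooth_projective_curve_def by metis
  have diff: "(\<lambda>Q. v Q - a * w Q) = v - scl a w" for v w :: "'a proj \<Rightarrow> complex" and a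
    by (simp add: fun_eq_iff scl_def)
  have bi: "b \<circ> ?i \<in> max_ideal X P" by (rule max_ideal_pullback(1)[OF P i b(1)])
  then obtain c where c: "(b \<circ> ?i) - scl c b \<in> max_ideal_sq X P" using b(2) by blast
  have "acts_by X P g c"
    unfolding acts_by_def
  proof
    fix f assume "f \<in> max_ideal X P"
    then obtain a where a: "f - scl a b \<in> max_ideal_sq X P" using b(2) by blast
    have "(f - scl a b) \<circ> ?i \<in> max_ideal_sq X P" by (rule max_ideal_pullback(2)[OF P i a])
    from max_ideal_sq_add[OF max_ideal_sq_add[OF this max_ideal_sq_scale[OF c, of a]]
        max_ideal_sq_scale[OF a, of "- c"]]
    show "(\<lambda>Q. f (?i Q) - c * f Q) \<in> max_ideal_sq X P"
      by (rule max_ideal_sq_cong) (simp add: scl_def algebra_simps)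
  qed
  moreover have "c' = c''" if "acts_by X P g c'" "acts_by X P g c''" for c' c''
  proof -
    have "(b \<circ> ?i) - scl c' b \<in> max_ideal_sq X P" "(b \<circ> ?i) - scl c'' b \<in> max_ideal_sq X P"
      using that b(1) by (auto simp: acts_by_def diff[symmetric])
    then show ?thesis using b(2)[OF bi] by blast
  qed
  ultimately show ?thesis by blast
qed

text \<open>Writing \<open>T\<close> for the action on functions,
  \<open>T\<^sub>g\<^sub>h f - c d f = T\<^sub>g (T\<^sub>h f - d f) + d (T\<^sub>g f - c f)\<close>, and both terms lie in the square of
  the maximal ideal.\<close>

lemma acts_by_mult:
  assumes P: "P \<in> X" and g: "g \<in> stab X P" "acts_by X P g c" and h: "h \<in> stab X P" "acts_by X P h d"
  shows "acts_by X P (g \<otimes>\<^bsub>aut_group X\<^esub> h) (c * d)"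
  unfolding acts_by_def
proof
  interpret group "aut_group X" by (rule group_aut_group)
  let ?g = "inv\<^bsub>aut_group X\<^esub> g" and ?h = "inv\<^bsub>aut_group X\<^esub> h"
  have car: "g \<in> carrier (aut_group X)" "h \<in> carrier (aut_group X)" using g h by (auto simp: stabilizer_def)
  have "?g \<in> stab X P" by (rule subgroup.m_inv_closed[OF subgroup_stab[OF P] g(1)])
  then have i: "morphism X X ?g" "?g P = P" by (auto simp: stabilizer_def aut_group_simps(1))
  fix f assume f: "f \<in> max_ideal X P"
  have 1: "(\<lambda>Q. f (?h Q) - d * f Q) \<circ> ?g \<in> max_ideal_sq X P"
    using h(2) f by (intro max_ideal_pullback(2)[OF P i]) (simp add: acts_by_def)
  have 2: "(\<lambda>Q. d * (f (?g Q) - c * f Q)) \<in> max_ideal_sq X P"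
    using g(2) f by (intro max_ideal_sq_scale) (simp add: acts_by_def)
  show "(\<lambda>Q. f ((inv\<^bsub>aut_group X\<^esub> (g \<otimes>\<^bsub>aut_group X\<^esub> h)) Q) - c * d * f Q) \<in> max_ideal_sq X P"
    by (rule max_ideal_sq_cong[OF max_ideal_sq_add[OF 1 2]])
       (use car in \<open>simp add: inv_mult_group aut_group_mult algebra_simps\<close>)
qed

lemma ram_char_linear_character:
  assumes X: "smooth_projective_curve X" and P: "P \<in> X"
  shows "linear_character (aut_group X) (stab X P) (ram_char X P)"
proof -
  interpret group "aut_group X" by (rule group_aut_group)
  interpret H: subgroup "stab X P" "aut_group X" by (rule subgroup_stab[OF P])
  note ex1 = acts_by_exists_unique[OF X P]
  have ram: "ram_char X P g = (THE c. acts_by X P g c)" for g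
    by (simp add: ram_char_def acts_by_def)
  have acts: "acts_by X P g (ram_char X P g)" if "g \<in> stab X P" for g
    unfolding ram by (rule theI'[OF ex1[OF that]])
  have eqI: "ram_char X P g = c" if "g \<in> stab X P" "acts_by X P g c" for g c
    using ex1[OF that(1)] acts[OF that(1)] that(2) by blast
  have "acts_by X P \<one>\<^bsub>aut_group X\<^esub> 1"
    unfolding acts_by_def
    by (auto intro!: max_ideal_sq_zero[OF P] simp: aut_group_simps(2)[symmetric]) (simp add: aut_group_simps(2))
  then have "ram_char X P \<one>\<^bsub>aut_group X\<^esub> = 1" by (intro eqI) auto
  moreover have "ram_char X P (g \<otimes>\<^bsub>aut_group X\<^esub> h) = ram_char X P g * ram_char X P h"
    if "g \<in> stab X P" "h \<in> stab X P" for g h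
    using that by (intro eqI acts_by_mult[OF P] acts) auto
  ultimately show ?thesis by (simp add: linear_character_def)
qed

section \<open>Conjugacy in the groups PSL(2,q)\<close>

lemma matrix_mult_2: "(A ** B)$i$j = A$i$1 * B$1$j + A$i$2 * B$2$j"
  for A B :: "'a::semiring_1^2^2"
  by (simp add: matrix_matrix_mult_def UNIV_2)

lemma SL2_group: "group (SL2 :: ('f::field^2^2) monoid)"
proof (rule groupI)
  fix A :: "'f^2^2" assume "A \<in> carrier SL2"
  then have A: "det A = 1" by (simp add: SL2_def)
  then obtain B where B: "B ** A = mat 1"
    using invertible_det_nz[of A] unfolding invertible_def by auto
  then have "det B = 1" by (metis A det_I det_mul mult.right_neutral)
  then show "\<exists>B\<in>carrier SL2. B \<otimes>\<^bsub>SL2\<^esub> A = \<one>\<^bsub>SL2\<^esub>" using B by (auto simp: SL2_def)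
qed (auto simp: SL2_def det_mul det_I matrix_mul_assoc)

lemma card_SL2:
  "card (carrier (SL2 :: ('f::{field,finite}^2^2) monoid)) = CARD('f) * (CARD('f)\<^sup>2 - 1)"
proof -
  define m :: "'f \<times> 'f \<times> 'f \<times> 'f \<Rightarrow> 'f^2^2" where
    "m = (\<lambda>(a, b, c, d). vector [vector [a, b], vector [c, d]])"
  define U :: "('f \<times> 'f \<times> 'f \<times> 'f) set" where "U = (\<lambda>(a, b, c). (a, b, c, (1 + b * c) / a)) ` ((UNIV - {0}) \<times> UNIV \<times> UNIV)"
  define W :: "('f \<times> 'f \<times> 'f \<times> 'f) set" where "W = (\<lambda>(b, d). (0, b, - 1 / b, d)) ` ((UNIV - {0}) \<times> UNIV)"
  have "inj m"
    by (auto simp: inj_on_def m_def) (metis vector_2)+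
  have "carrier SL2 = m ` (U \<union> W)"
  proof (intro subset_antisym subsetI)
    fix A :: "'f^2^2" assume "A \<in> carrier SL2"
    then have A: "A$1$1 * A$2$2 - A$1$2 * A$2$1 = 1" by (simp add: SL2_def det_2)
    have eq: "A = m (A$1$1, A$1$2, A$2$1, A$2$2)"
      by (simp add: m_def vec_eq_iff forall_2)
    have "(A$1$1, A$1$2, A$2$1, A$2$2) \<in> U \<union> W"
    proof (cases "A$1$1 = 0")
      case True
      then have "A$2$1 * A$1$2 = - 1"
        using arg_cong[OF A, of uminus] by (simp add: mult.commute)
      moreover from this have nz: "A$1$2 \<noteq> 0" by auto
      ultimately have "A$2$1 = - 1 / A$1$2" by (simp only: nonzero_eq_divide_eq not_False_eq_True)
      with nz show ?thesis using True unfolding W_def by force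
    next
      case False
      then have "A$2$2 = (1 + A$1$2 * A$2$1) / A$1$1"
        using A by (auto simp: field_simps)
      then show ?thesis
        using False unfolding U_def
        by (intro UnI1 image_eqI[where x = "(A$1$1, A$1$2, A$2$1)"]) simp_all
    qed
    then show "A \<in> m ` (U \<union> W)" using eq by blast
  qed (auto simp: SL2_def det_2 m_def U_def W_def split: if_splits)
  then have "card (carrier (SL2 :: ('f^2^2) monoid)) = card (U \<union> W)"
    using card_image[OF inj_on_subset[OF \<open>inj m\<close> subset_UNIV]] by simp
  also have "\<dots> = card U + card W"
    by (rule card_Un_disjoint) (auto simp: U_def W_def)
  also have "card U = (CARD('f) - 1) * CARD('f) * CARD('f)"
    unfolding U_def by (subst card_image) (auto simp: inj_on_def card_cartesian_product card_Diff_singleton)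
  also have "card W = (CARD('f) - 1) * CARD('f)"
    unfolding W_def by (subst card_image) (auto simp: inj_on_def card_cartesian_product card_Diff_singleton)
  also have "(CARD('f) - 1) * CARD('f) * CARD('f) + (CARD('f) - 1) * CARD('f) = CARD('f) * (CARD('f)\<^sup>2 - 1)"
    by (cases "CARD('f)") (auto simp: algebra_simps power2_eq_square)
  finally show ?thesis .
qed

abbreviation scalar_SL2 :: "('f::field^2^2) set" where
  "scalar_SL2 \<equiv> {A \<in> carrier SL2. \<exists>c. A = mat c}"

lemma mat_commute: "mat c ** A = A ** mat c" for A :: "'f::field^2^2"
  by (simp add: vec_eq_iff forall_2 matrix_mult_2 mat_def mult.commute)

lemma scalar_SL2_normal: "scalar_SL2 \<lhd> (SL2 :: ('f::field^2^2) monoid)"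
proof -
  interpret group "SL2 :: ('f^2^2) monoid" by (rule SL2_group)
  have commute: "A \<otimes>\<^bsub>SL2\<^esub> B = B \<otimes>\<^bsub>SL2\<^esub> A" if "A \<in> scalar_SL2" for A B :: "'f^2^2"
    using that by (auto simp: SL2_def mat_commute)
  have "subgroup (scalar_SL2 :: ('f^2^2) set) SL2"
  proof (rule subgroupI)
    have "mat 1 \<in> (scalar_SL2 :: ('f^2^2) set)" by (auto simp: SL2_def det_I)
    then show "scalar_SL2 \<noteq> ({} :: ('f^2^2) set)" by blast
  next
    fix A :: "'f^2^2" assume A: "A \<in> scalar_SL2"
    then obtain c where c: "A = mat c" "c * c = 1" by (auto simp: SL2_def det_2 mat_def)
    then have "A \<otimes>\<^bsub>SL2\<^esub> A = \<one>\<^bsub>SL2\<^esub>"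
      by (simp add: SL2_def vec_eq_iff forall_2 matrix_mult_2 mat_def)
    then have "inv\<^bsub>SL2\<^esub> A = A" using A by (intro inv_equality) auto
    then show "inv\<^bsub>SL2\<^esub> A \<in> scalar_SL2" using A by simp
  next
    fix A B :: "'f^2^2" assume AB: "A \<in> scalar_SL2" "B \<in> scalar_SL2"
    then obtain c d where "A = mat c" "B = mat d" by blast
    then have "A \<otimes>\<^bsub>SL2\<^esub> B = mat (c * d)"
      by (simp add: SL2_def vec_eq_iff forall_2 matrix_mult_2 mat_def)
    moreover have "A \<otimes>\<^bsub>SL2\<^esub> B \<in> carrier SL2" using AB by blast
    ultimately show "A \<otimes>\<^bsub>SL2\<^esub> B \<in> scalar_SL2" by blast
  qed auto
  moreover have "x \<otimes>\<^bsub>SL2\<^esub> h \<otimes>\<^bsub>SL2\<^esub> inv\<^bsub>SL2\<^esub> x \<in> scalar_SL2"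
    if "x \<in> carrier SL2" "h \<in> scalar_SL2" for x h :: "'f^2^2"
  proof -
    have "h \<in> carrier SL2" using that(2) by blast
    then have "x \<otimes>\<^bsub>SL2\<^esub> h \<otimes>\<^bsub>SL2\<^esub> inv\<^bsub>SL2\<^esub> x = h"
      unfolding commute[OF that(2), of x, symmetric] using that(1) by (simp only: m_assoc r_inv r_one inv_closed)
    then show ?thesis using that(2) by (simp only:)
  qed
  ultimately show ?thesis by (auto simp: normal_inv_iff)
qed

lemma card_PSL2_dvd:
  "card (carrier (PSL2 :: ('f::{field,finite}^2^2) set monoid)) dvd CARD('f) * (CARD('f)\<^sup>2 - 1)"
proof -
  interpret normal scalar_SL2 "SL2 :: ('f^2^2) monoid" by (rule scalar_SL2_normal)
  have "card (rcosets\<^bsub>SL2\<^esub> (scalar_SL2 :: ('f^2^2) set)) dvd order (SL2 :: ('f^2^2) monoid)"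
    unfolding lagrange[OF subgroup_axioms, symmetric] by (rule dvd_triv_left)
  then show ?thesis by (simp only: PSL2_def FactGroup_def order_def card_SL2 partial_object.simps)
qed

text \<open>Squaring is at most two-to-one, and one-to-one above \<open>0\<close>.\<close>

lemma card_squares_ge: "CARD('f) + 1 \<le> 2 * card (range (\<lambda>x::'f::{field,finite}. x\<^sup>2))"
proof -
  let ?R = "range (\<lambda>x::'f. x\<^sup>2)"
  have "(UNIV :: 'f set) = (\<Union>y\<in>?R. {x. x\<^sup>2 = y})" by auto
  then have "CARD('f) \<le> (\<Sum>y\<in>?R. card {x. x\<^sup>2 = y})"
    by (metis card_UN_le finite)
  also have "\<dots> \<le> (\<Sum>y\<in>?R. if y = 0 then 1 else 2)"
  proof (rule sum_mono)
    fix y assume "y \<in> ?R"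
    then obtain z where z: "y = z\<^sup>2" by blast
    have "{x. x\<^sup>2 = y} = {z, - z}" by (auto simp: z power2_eq_iff)
    then show "card {x. x\<^sup>2 = y} \<le> (if y = 0 then 1 else 2)"
      by (auto simp: z card_insert_if)
  qed
  also have "\<dots> = 1 + (\<Sum>y\<in>?R - {0}. 2)"
  proof -
    have "0 \<in> ?R" by (rule image_eqI[of _ _ 0]) auto
    then show ?thesis by (simp add: sum.remove[of ?R 0])
  qed
  finally have "CARD('f) \<le> 1 + (\<Sum>y\<in>?R - {0}. 2)" .
  moreover have "1 + (\<Sum>y\<in>?R - {0}. 2) = 1 + 2 * (card ?R - 1)"
  proof -
    have "0 \<in> ?R" by (rule image_eqI[of _ _ 0]) auto
    then show ?thesis by (simp add: card_Diff_singleton)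
  qed
  moreover have "card ?R > 0" by (simp add: card_gt_0_iff)
  ultimately show ?thesis by linarith
qed

text \<open>The sets of values \<open>u\<^sup>2 + 1\<close> and \<open>\<Delta> w\<^sup>2\<close> both have more than half as many elements as the
  field, so they meet.\<close>

lemma square_plus_one_eq_multiple_of_square:
  fixes \<Delta> :: "'f::{field,finite}"
  assumes "\<Delta> \<noteq> 0"
  obtains u w where "u\<^sup>2 + 1 = \<Delta> * w\<^sup>2"
proof -
  let ?R = "range (\<lambda>x::'f. x\<^sup>2)"
  have "card ((\<lambda>y. y + 1) ` ?R) = card ?R" "card ((\<lambda>y. \<Delta> * y) ` ?R) = card ?R"
    using assms by (auto intro!: card_image inj_onI)
  then have "CARD('f) < card ((\<lambda>y. y + 1) ` ?R) + card ((\<lambda>y. \<Delta> * y) ` ?R)"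
    using card_squares_ge[where 'f = 'f] by linarith
  then have "((\<lambda>y. y + 1) ` ?R) \<inter> ((\<lambda>y. \<Delta> * y) ` ?R) \<noteq> {}"
    by (metis card_Un_disjoint card_mono finite leD subset_UNIV)
  then show ?thesis using that by auto
qed

text \<open>If \<open>M\<close> and \<open>M A\<close> both have trace \<open>0\<close>, then taking adjugates gives \<open>M A = A\<^sup>-\<^sup>1 M\<close>. The
  matrices \<open>M\<close> subject to these two linear conditions form, for \<open>A\<close> not scalar, a plane on which the determinant is a
  binary quadratic form; its discriminant is, up to squares, that of the characteristic
  polynomial of \<open>A\<close>. If this is not \<open>0\<close>, the form represents \<open>1\<close> over the finite field. The remaining
  matrices that are admitted are diagonal, and there a fixed \<open>M\<close> serves for all of them.\<close>

lemma SL2_conjugate_to_inverse: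
  fixes A :: "'f::{field,finite}^2^2"
  assumes A: "det A = 1"
    and regular: "(A$1$1 + A$2$2)\<^sup>2 \<noteq> 4 \<or> A$1$2 = 0 \<and> A$2$1 = 0"
  obtains M where "det M = 1" "A ** M ** A = M"
proof -
  obtain a b c d where abcd: "A$1$1 = a" "A$1$2 = b" "A$2$1 = c" "A$2$2 = d" by blast
  have det: "a * d - b * c = 1" using A by (simp add: det_2 abcd)
  have "\<exists>x y z. - x * x - y * z = 1 \<and> x * (a - d) + y * c + z * b = 0"
  proof (cases "b = 0 \<and> c = 0")
    case True
    then have "- 0 * 0 - 1 * (- 1) = (1::'f) \<and> 0 * (a - d) + 1 * c + (- 1) * b = 0" by simp
    then show ?thesis by blast
  next
    case False
    then have "(a + d)\<^sup>2 - 4 \<noteq> 0" using regular by (auto simp: abcd)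
    then obtain u w where uw: "u\<^sup>2 + 1 = ((a + d)\<^sup>2 - 4) * w\<^sup>2"
      by (rule square_plus_one_eq_multiple_of_square)
    have "(a + d)\<^sup>2 - 4 * (a * d - b * c) = (a - d)\<^sup>2 + 4 * (b * c)"
      by (simp add: power2_eq_square algebra_simps)
    then have "(a + d)\<^sup>2 - 4 = (a - d)\<^sup>2 + 4 * (b * c)" by (simp add: det)
    with uw have uw: "u * u + 1 = ((a - d) * (a - d) + 4 * (b * c)) * (w * w)"
      by (simp add: power2_eq_square)
    \<comment> \<open>Completing the square in \<open>- x\<^sup>2 - y z\<close> on the plane, with \<open>z = 2 c w\<close> (or \<open>y = 2 b w\<close> if
      \<open>c = 0\<close>), turns the form into \<open>- u\<^sup>2 + \<Delta> w\<^sup>2\<close> where \<open>\<Delta>\<close> is the discriminant.\<close>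
    define x where "x = u + w * (a - d)"
    have "- x * x + 2 * w * (x * (a - d) + 2 * c * w * b) =
        ((a - d) * (a - d) + 4 * (b * c)) * (w * w) - u * u"
      unfolding x_def by (simp add: algebra_simps)
    then have form: "- x * x + 2 * w * (x * (a - d) + 2 * c * w * b) = 1"
      unfolding uw[symmetric] by simp
    show ?thesis
    proof (cases "c = 0")
      case True
      then have b: "b \<noteq> 0" using False by simp
      have "- x * x - 2 * b * w * (- (x * (a - d)) / b) = 1"
        using b form True by (simp add: mult.assoc)
      moreover have "x * (a - d) + 2 * b * w * c + - (x * (a - d)) / b * b = 0"
        using b True by simp
      ultimately show ?thesis by blast
    next
      case c: False
      have "- (x * (a - d) + 2 * c * w * b) / c * (2 * c * w) = - (2 * w * (x * (a - d) + 2 * c * w * b))"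
        using c by (simp add: field_simps)
      then have "- x * x - (- (x * (a - d) + 2 * c * w * b) / c) * (2 * c * w) = 1"
        using form by simp
      moreover have "x * (a - d) + - (x * (a - d) + 2 * c * w * b) / c * c + 2 * c * w * b = 0"
        using c by simp
      ultimately show ?thesis by blast
    qed
  qed
  then obtain x y z where xyz: "- x * x - y * z = 1" "x * (a - d) + y * c + z * b = 0" by blast
  define M :: "'f^2^2" where "M = vector [vector [x, y], vector [z, - x]]"
  have "det M = 1" using xyz(1) by (simp add: M_def det_2)
  moreover have trace: "x * a + y * c = x * d - z * b" using xyz(2) by (simp add: algebra_simps)
  have "A ** M ** A = M"
  proof -
    have "(a * x + b * z) * a + (a * y + b * - x) * c = a * (x * a + y * c) + b * (z * a - x * c)"
      by (simp add: algebra_simps)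
    also have "\<dots> = x * (a * d - b * c)" unfolding trace by (simp add: algebra_simps)
    finally have 1: "(a * x + b * z) * a + (a * y + b * - x) * c = x" by (simp add: det)
    have "(a * x + b * z) * b + (a * y + b * - x) * d = a * (x * b + y * d) - b * (x * d - z * b)"
      by (simp add: algebra_simps)
    also have "\<dots> = y * (a * d - b * c)" unfolding trace[symmetric] by (simp add: algebra_simps)
    finally have 2: "(a * x + b * z) * b + (a * y + b * - x) * d = y" by (simp add: det)
    have "(c * x + d * z) * a + (c * y + d * - x) * c = c * (x * a + y * c) + d * (z * a - x * c)"
      by (simp add: algebra_simps)
    also have "\<dots> = z * (a * d - b * c)" unfolding trace by (simp add: algebra_simps)
    finally have 3: "(c * x + d * z) * a + (c * y + d * - x) * c = z" by (simp add: det)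
    have "(c * x + d * z) * b + (c * y + d * - x) * d = c * (x * b + y * d) - d * (x * d - z * b)"
      by (simp add: algebra_simps)
    also have "\<dots> = - x * (a * d - b * c)" unfolding trace[symmetric] by (simp add: algebra_simps)
    finally have 4: "(c * x + d * z) * b + (c * y + d * - x) * d = - x" by (simp add: det)
    show ?thesis
      using 1 2 3 4 by (simp add: vec_eq_iff forall_2 matrix_mult_2 M_def abcd)
  qed
  ultimately show ?thesis by (rule that)
qed

text \<open>Here \<open>A = s + N\<close> with \<open>s = \<plusminus>1\<close> and \<open>N\<^sup>2 = 0\<close> by Cayley-Hamilton, so
  \<open>A\<^sup>n = s\<^sup>n + n s\<^sup>n\<^sup>-\<^sup>1 N\<close>. As \<open>s\<^sup>-\<^sup>1 = s\<close>, this is written without the exponent \<open>n - 1\<close>.\<close>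

lemma SL2_unipotent_power:
  fixes A :: "'f::field^2^2"
  assumes A: "A \<in> carrier SL2" "A$1$1 + A$2$2 = 2 * s" "s * s = 1"
  shows "(A [^]\<^bsub>SL2\<^esub> n)$i$j = s ^ n * ((mat 1 :: 'f^2^2)$i$j + of_nat n * s * (A - mat s)$i$j)"
proof -
  obtain a b c d where abcd: "A$1$1 = a" "A$1$2 = b" "A$2$1 = c" "A$2$2 = d" by blast
  have det: "a * d - b * c = 1" using A by (simp add: det_2 abcd SL2_def)
  define e where "e = a - s"
  have a: "a = s + e" and d: "d = s - e" using A(2) by (auto simp: abcd e_def algebra_simps)
  have "b * c = s * s - e * e - 1" using det unfolding a d by (simp add: algebra_simps)
  then have bc: "b * c = - (e * e)" by (simp add: A(3))
  have "\<forall>i j. (A [^]\<^bsub>SL2\<^esub> n)$i$j = s ^ n * ((mat 1 :: 'f^2^2)$i$j + of_nat n * s * (A - mat s)$i$j)"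
  proof (induction n)
    case 0
    then show ?case by (simp add: SL2_def)
  next
    case (Suc n)
    define N where "N = (of_nat n :: 'f)"
    have "(1 + N * s * e) * (s + e) + N * s * b * c =
        s * (1 + (1 + N) * s * e) + (e * (1 - s * s) + N * s * (b * c + e * e))"
      by (simp add: algebra_simps)
    moreover have "(1 + N * s * e) * b + N * s * b * (s - e) =
        s * ((1 + N) * s * b) + b * (1 - s * s)"
      by (simp add: algebra_simps)
    moreover have "N * s * c * (s + e) + (1 + N * s * - e) * c =
        s * ((1 + N) * s * c) + c * (1 - s * s)"
      by (simp add: algebra_simps)
    moreover have "N * s * c * b + (1 + N * s * - e) * (s - e) =
        s * (1 + (1 + N) * s * - e) + (N * s * (b * c + e * e) - e * (1 - s * s))"
      by (simp add: algebra_simps)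
    moreover have "1 - s * s = 0" "b * c + e * e = 0" by (simp_all add: A(3) bc)
    ultimately have "(1 + N * s * e) * (s + e) + N * s * b * c = s * (1 + (1 + N) * s * e)"
      "(1 + N * s * e) * b + N * s * b * (s - e) = s * ((1 + N) * s * b)"
      "N * s * c * (s + e) + (1 + N * s * - e) * c = s * ((1 + N) * s * c)"
      "N * s * c * b + (1 + N * s * - e) * (s - e) = s * (1 + (1 + N) * s * - e)"
      by (simp_all only: mult_zero_right add_0_right diff_zero)
    note step = this
    define t where "t = s ^ n"
    have entries: "(A [^]\<^bsub>SL2\<^esub> n)$1$1 = t * (1 + N * s * e)" "(A [^]\<^bsub>SL2\<^esub> n)$1$2 = t * (N * s * b)"
      "(A [^]\<^bsub>SL2\<^esub> n)$2$1 = t * (N * s * c)" "(A [^]\<^bsub>SL2\<^esub> n)$2$2 = t * (1 + N * s * - e)"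
      using Suc by (simp_all add: mat_def abcd a d N_def t_def)
    have factor: "t * x * y + t * z * w = t * (x * y + z * w)" for x y z w
      by (simp add: algebra_simps)
    have power: "A [^]\<^bsub>SL2\<^esub> Suc n = A [^]\<^bsub>SL2\<^esub> n ** A"
      by (simp add: nat_pow_def SL2_def)
    have "(A [^]\<^bsub>SL2\<^esub> Suc n)$1$1 = t * (s * (1 + (1 + N) * s * e))"
      "(A [^]\<^bsub>SL2\<^esub> Suc n)$1$2 = t * (s * ((1 + N) * s * b))"
      "(A [^]\<^bsub>SL2\<^esub> Suc n)$2$1 = t * (s * ((1 + N) * s * c))"
      "(A [^]\<^bsub>SL2\<^esub> Suc n)$2$2 = t * (s * (1 + (1 + N) * s * - e))"
      unfolding power matrix_mult_2 entries abcd step[symmetric] a d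
      by (simp_all only: factor)
    then show ?case
      by (simp add: forall_2 mat_def abcd a d N_def t_def mult_ac)
  qed
  then show ?thesis by blast
qed

text \<open>A matrix in \<open>SL\<^sub>2\<close> of trace \<open>\<plusminus>2\<close> that is not diagonal is \<open>\<plusminus>1\<close> times a nontrivial unipotent one,
  so its \<open>n\<close>-th power is scalar only if \<open>n\<close> vanishes in the field.\<close>

lemma SL2_regular_of_finite_order:
  fixes A :: "'f::field^2^2"
  assumes A: "A \<in> carrier SL2" "A [^]\<^bsub>SL2\<^esub> n = mat c" and n: "of_nat n \<noteq> (0::'f)" and two: "2 \<noteq> (0::'f)"
  shows "(A$1$1 + A$2$2)\<^sup>2 \<noteq> 4 \<or> A$1$2 = 0 \<and> A$2$1 = 0"
proof (rule disjCI)
  assume nz: "\<not> (A$1$2 = 0 \<and> A$2$1 = 0)"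
  show "(A$1$1 + A$2$2)\<^sup>2 \<noteq> 4"
  proof
    assume tr: "(A$1$1 + A$2$2)\<^sup>2 = 4"
    define s where "s = (A$1$1 + A$2$2) / 2"
    have 4: "(4::'f) = 2 * 2" by simp
    then have "(4::'f) \<noteq> 0" using two by (metis mult_eq_0_iff)
    then have s: "A$1$1 + A$2$2 = 2 * s" "s * s = 1"
      using tr two by (simp_all add: s_def power_divide flip: power2_eq_square)
    then have "s \<noteq> 0" by auto
    have "s ^ n * (of_nat n * s * A$i$j) = 0" if "i \<noteq> j" for i j
      using SL2_unipotent_power[OF A(1) s, of n i j] A(2) that by (simp add: mat_def)
    then show False using nz n \<open>s \<noteq> 0\<close> by simp
  qed
qed

lemma PSL2_group: "group (PSL2 :: ('f::field^2^2) set monoid)"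
  unfolding PSL2_def by (rule normal.factorgroup_is_group[OF scalar_SL2_normal])

lemma one_PSL2: "\<one>\<^bsub>PSL2\<^esub> = (scalar_SL2 :: ('f::field^2^2) set)"
  by (simp add: PSL2_def FactGroup_def)

text \<open>The equation \<open>x y x = y\<close> says \<open>y x y\<^sup>-\<^sup>1 = x\<^sup>-\<^sup>1\<close>.\<close>

lemma PSL2_conjugate_to_inverse:
  fixes x :: "('f::{field,finite}^2^2) set"
  assumes x: "x \<in> carrier PSL2" "x [^]\<^bsub>PSL2\<^esub> (n::nat) = \<one>\<^bsub>PSL2\<^esub>"
    and n: "of_nat n \<noteq> (0::'f)" and two: "2 \<noteq> (0::'f)"
  obtains y where "y \<in> carrier PSL2" "x \<otimes>\<^bsub>PSL2\<^esub> y \<otimes>\<^bsub>PSL2\<^esub> x = y"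
proof -
  let ?N = "scalar_SL2 :: ('f^2^2) set"
  interpret normal ?N "SL2 :: ('f^2^2) monoid" by (rule scalar_SL2_normal)
  interpret P: group "PSL2 :: ('f^2^2) set monoid" by (rule PSL2_group)
  have \<pi>: "(\<lambda>A. ?N #>\<^bsub>SL2\<^esub> A) \<in> hom SL2 PSL2"
    unfolding PSL2_def by (rule r_coset_hom_Mod)
  then interpret \<pi>: group_hom SL2 PSL2 "\<lambda>A. ?N #>\<^bsub>SL2\<^esub> A"
    by (intro group_hom.intro group_hom_axioms.intro SL2_group P.group_axioms)
  obtain A where A: "A \<in> carrier SL2" "x = ?N #>\<^bsub>SL2\<^esub> A"
    using x(1) unfolding PSL2_def FactGroup_def RCOSETS_def partial_object.simps by blast
  have "?N #>\<^bsub>SL2\<^esub> (A [^]\<^bsub>SL2\<^esub> n) = ?N"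
    using x(2) unfolding A(2) \<pi>.hom_nat_pow[OF A(1)] one_PSL2 .
  then have "A [^]\<^bsub>SL2\<^esub> n \<in> ?N"
    by (rule coset_join1[OF _ nat_pow_closed[OF A(1)] subgroup_axioms])
  then obtain c where "A [^]\<^bsub>SL2\<^esub> n = mat c" unfolding mem_Collect_eq by (elim conjE exE)
  then have regular: "(A$1$1 + A$2$2)\<^sup>2 \<noteq> 4 \<or> A$1$2 = 0 \<and> A$2$1 = 0"
    using SL2_regular_of_finite_order[OF A(1) _ n two] by blast
  have "det A = 1" using A(1) by (simp add: SL2_def)
  then obtain M where M: "det M = 1" "A ** M ** A = M"
    by (rule SL2_conjugate_to_inverse[OF _ regular])
  have M': "M \<in> carrier SL2" "A \<otimes>\<^bsub>SL2\<^esub> M \<otimes>\<^bsub>SL2\<^esub> A = M"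
    unfolding SL2_def monoid.simps partial_object.simps mem_Collect_eq by (rule M)+
  show ?thesis
  proof (rule that)
    show "?N #>\<^bsub>SL2\<^esub> M \<in> carrier PSL2" by (rule \<pi>.hom_closed[OF M'(1)])
    show "x \<otimes>\<^bsub>PSL2\<^esub> (?N #>\<^bsub>SL2\<^esub> M) \<otimes>\<^bsub>PSL2\<^esub> x = ?N #>\<^bsub>SL2\<^esub> M"
      unfolding A(2) using A(1) M' by (simp only: \<pi>.hom_mult[symmetric] m_closed)
  qed
qed

lemma of_nat_neq_0_if_coprime_card:
  assumes "coprime n CARD('f::{field,finite})"
  shows "of_nat n \<noteq> (0::'f)"
proof
  assume "of_nat n = (0::'f)"
  then have "CHAR('f) dvd n" by (simp add: of_nat_eq_0_iff_char_dvd)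
  with assms CHAR_dvd_CARD[where 'a = 'f] have "CHAR('f) = 1"
    by (metis coprime_common_divisor_nat)
  then show False by simp
qed

section \<open>Symmetrised geometric sums\<close>

text \<open>The factor of \<open>\<chi> h\<close> in the coefficient of \<open>deg\<^sub>e\<^sub>q (r D\<^sub>P)\<close>, where \<open>z\<close> is the value of the
  ramification character at \<open>h\<close>. The three cases are those of the equivariant degree; for \<open>z \<noteq> 0, 1\<close> they
  agree with \<open>z (z\<^sup>r - 1) / (z - 1)\<close> for all \<open>r\<close>, so for a root of unity \<open>z \<noteq> 1\<close> only \<open>r\<close> modulo its
  order matters.\<close>

definition ram_sum :: "int \<Rightarrow> complex \<Rightarrow> complex" where
  "ram_sum r z = (if r > 0 then \<Sum>l\<in>{1..r}. z powi l
     else if r = 0 then 0 else - (\<Sum>l\<in>{0..\<bar>r\<bar> - 1}. inverse (z powi l)))"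

lemma sum_int_from_1: "(\<Sum>l\<in>{1..int n}. f l) = (\<Sum>j<n. f (int (Suc j)))"
  by (rule sum.reindex_bij_witness[of _ "\<lambda>j. int (Suc j)" "\<lambda>l. nat l - 1"]) auto

lemma sum_int_from_0: "(\<Sum>l\<in>{0..int n - 1}. f l) = (\<Sum>j<n. f (int j))"
  by (rule sum.reindex_bij_witness[of _ int nat]) auto

lemma ram_sum_1: "ram_sum r 1 = of_int r"
  by (auto simp: ram_sum_def)

lemma ram_sum_closed_form:
  assumes "z \<noteq> 0"
  shows "(z - 1) * ram_sum r z = z * (z powi r - 1)"
proof (cases "r \<ge> 0")
  case True
  then obtain n where n: "r = int n" by (metis nonneg_int_cases)
  have "(z - 1) * (\<Sum>j<n. z powi int (Suc j)) = z * (z powi int n - 1)"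
    by (induction n) (auto simp: algebra_simps power_int_def nat_add_distrib)
  then show ?thesis
    by (cases "n = 0") (auto simp: ram_sum_def n sum_int_from_1)
next
  case False
  then have "r = - int (nat (- r))" "nat (- r) > 0" by auto
  then obtain n where n: "r = - int n" "n > 0" by blast
  have cancel: "z * (inverse z * x) = x" for x using assms by (simp add: mult.assoc[symmetric])
  have "(z - 1) * (- (\<Sum>j<n. inverse z ^ j)) = z * (inverse z ^ n - 1)"
    by (induction n) (simp_all add: algebra_simps cancel)
  then have "(z - 1) * (- (\<Sum>j<n. inverse (z powi int j))) = z * (z powi - int n - 1)"
    by (simp add: power_int_minus power_inverse)
  then show ?thesis
    using n by (simp add: ram_sum_def sum_int_from_0)
qed

lemma ram_sum_symmetrised:
  assumes z: "z \<noteq> 0" "z \<noteq> 1"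
  shows "(z - 1) * (ram_sum r z + ram_sum r (inverse z)) = z powi (r + 1) - z powi (- r) - (z - 1)"
proof -
  have "(z - 1) * ram_sum r (inverse z) = - z * ((inverse z - 1) * ram_sum r (inverse z))"
    using z by (simp add: field_simps)
  also have "\<dots> = - (z * inverse z) * (inverse z powi r - 1)"
    by (simp only: ram_sum_closed_form[OF nonzero_imp_inverse_nonzero[OF z(1)]] mult_minus_left mult.assoc)
  also have "\<dots> = - (z powi (- r) - 1)"
    using z by (simp add: power_int_minus power_int_inverse)
  finally have inverse: "(z - 1) * ram_sum r (inverse z) = - (z powi (- r) - 1)" .
  show ?thesis
    unfolding distrib_left inverse ram_sum_closed_form[OF z(1)]
    using z(1) by (simp add: power_int_add algebra_simps)
qed

text \<open>The integer \<open>k\<close> is \<open>0\<close>, \<open>-2\<close> and \<open>-1\<close> in the three cases; what matters is that it does not depend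
  on \<open>z\<close>.\<close>

lemma ram_sum_symmetrised_constant:
  assumes p: "p > 0" and r: "int p dvd r \<or> int p dvd r + 1 \<or> int p dvd 2 * r + 1"
  obtains k :: int where "\<And>z. z ^ p = 1 \<Longrightarrow> z \<noteq> 1 \<Longrightarrow> ram_sum r z + ram_sum r (inverse z) = of_int k"
proof -
  have powi: "z powi s = 1" if z: "z ^ p = 1" and s: "int p dvd s" for z :: complex and s
  proof -
    obtain t where "s = int p * t" using s by blast
    then show ?thesis using z by (simp add: power_int_mult)
  qed
  have nz: "z \<noteq> 0" if "z ^ p = 1" for z :: complex using that p by (auto simp: zero_power)
  have *: "ram_sum r z + ram_sum r (inverse z) = of_int k"
    if z: "z ^ p = 1" "z \<noteq> 1" and eq: "z powi (r + 1) - z powi (- r) - (z - 1) = of_int k * (z - 1)" for z k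
  proof -
    have "(z - 1) * (ram_sum r z + ram_sum r (inverse z)) = (z - 1) * of_int k"
      using ram_sum_symmetrised[OF nz[OF z(1)] z(2), of r] eq by (simp add: mult.commute)
    then show ?thesis using z(2) by simp
  qed
  from r consider "int p dvd r" | "int p dvd r + 1" | "int p dvd 2 * r + 1" by blast
  then show ?thesis
  proof cases
    case 1
    show ?thesis
      by (rule that[of 0], rule *) (auto simp: powi 1 power_int_add nz)
  next
    case 2
    have "z powi (- r) = z" if z: "z ^ p = 1" for z :: complex
    proof -
      have "z powi (- r) = z powi (1 + - (r + 1))" by simp
      also have "\<dots> = z"
        using powi[OF z, of "- (r + 1)", unfolded dvd_minus_iff, OF 2] nz[OF z]
        by (subst power_int_add) auto
      finally show ?thesis .
    qed
    then show ?thesis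
      by (intro that[of "-2"], intro *) (auto simp: powi 2)
  next
    case 3
    have "z powi (r + 1) = z powi (- r)" if z: "z ^ p = 1" for z :: complex
    proof -
      have "z powi (r + 1) = z powi ((2 * r + 1) + - r)" by (simp add: algebra_simps)
      also have "\<dots> = z powi (- r)" using 3 z nz[OF z] by (subst power_int_add) (auto simp: powi)
      finally show ?thesis .
    qed
    then show ?thesis
      by (intro that[of "-1"], intro *) auto
  qed
qed

section \<open>Galois invariance for one orbit\<close>

text \<open>The equivariant degree of \<open>r\<close> times an orbit, for an abstract group \<open>G\<close> with stabilizer \<open>H\<close> and
  ramification character \<open>\<theta>\<close>.\<close>

definition ram_induced :: "'g monoid \<Rightarrow> 'g set \<Rightarrow> ('g \<Rightarrow> complex) \<Rightarrow> int \<Rightarrow> 'g vrep" where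
  "ram_induced G H \<theta> r =
     (let ind = (\<lambda>l::int. rep_class G (Ind G H (\<lambda>h. \<theta> h powi l)))
      in if r > 0 then (\<Sum>l\<in>{1..r}. ind (- l))
         else if r = 0 then 0
         else - (\<Sum>l\<in>{0..\<bar>r\<bar> - 1}. ind l))"

lemma ram_induced_coefficient:
  assumes G: "group G" and H: "subgroup H G" "finite H"
    and rep: "is_rep G S" and \<theta>: "linear_character G H \<theta>"
  shows "of_nat (card H) * of_int (ram_induced G H \<theta> r S) =
    (\<Sum>h\<in>H. ram_sum r (\<theta> h) * rep_char S h)"
proof -
  have ind: "of_nat (card H) * of_int (rep_class G (Ind G H (\<lambda>h. \<theta> h powi l)) S) =
      (\<Sum>h\<in>H. inverse (\<theta> h powi l) * rep_char S h)" for l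
  proof (rule frobenius_reciprocity_character[OF G H rep])
    show "linear_character G H (\<lambda>h. \<theta> h powi l)"
      using \<theta> by (simp add: linear_character_def power_int_mult_distrib)
  qed
  have swap: "of_nat (card H) * of_int (\<Sum>l\<in>L. rep_class G (Ind G H (\<lambda>h. \<theta> h powi e l)) S) =
      (\<Sum>h\<in>H. (\<Sum>l\<in>L. inverse (\<theta> h powi e l)) * rep_char S h)" for L and e :: "int \<Rightarrow> int"
  proof -
    have "of_nat (card H) * of_int (\<Sum>l\<in>L. rep_class G (Ind G H (\<lambda>h. \<theta> h powi e l)) S) =
        (\<Sum>l\<in>L. of_nat (card H) * of_int (rep_class G (Ind G H (\<lambda>h. \<theta> h powi e l)) S))"
      by (simp only: of_int_sum sum_distrib_left)
    also have "\<dots> = (\<Sum>l\<in>L. \<Sum>h\<in>H. inverse (\<theta> h powi e l) * rep_char S h)"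
      by (simp only: ind)
    also have "\<dots> = (\<Sum>h\<in>H. (\<Sum>l\<in>L. inverse (\<theta> h powi e l)) * rep_char S h)"
      by (subst sum.swap) (simp only: sum_distrib_right)
    finally show ?thesis .
  qed
  consider "r > 0" | "r = 0" | "r < 0" by linarith
  then show ?thesis
  proof cases
    case 1
    then show ?thesis
      using swap[where L = "{1..r}" and e = uminus]
      by (simp add: ram_induced_def ram_sum_def sum_fun_apply power_int_minus)
  next
    case 2
    then show ?thesis by (simp add: ram_induced_def ram_sum_def)
  next
    case 3
    then show ?thesis
      using swap[where L = "{0..\<bar>r\<bar> - 1}" and e = "\<lambda>l. l"]
      by (simp add: ram_induced_def ram_sum_def sum_fun_apply sum_negf)
  qed
qed

lemma gal_sum:
  assumes \<sigma>: "\<sigma> \<in> gal K" and K: "complex_subfield K" and f: "\<And>i. i \<in> I \<Longrightarrow> f i \<in> K"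
  shows "\<sigma> (\<Sum>i\<in>I. f i) = (\<Sum>i\<in>I. \<sigma> (f i))"
  using f
proof (induction I rule: infinite_finite_induct)
  case (insert i I)
  have "(\<Sum>i\<in>I. f i) \<in> K" "f i \<in> K" using insert.prems by (auto intro: complex_subfield_sum[OF K])
  then have "\<sigma> (f i + (\<Sum>i\<in>I. f i)) = \<sigma> (f i) + \<sigma> (\<Sum>i\<in>I. f i)"
    using \<sigma> by (simp add: gal_def)
  then show ?case using insert by simp
qed (use \<sigma> in \<open>auto simp: gal_def\<close>)

text \<open>The sum over \<open>U\<close> is \<open>|U|\<close> times the multiplicity of the trivial character of \<open>U\<close>, so it is
  rational and \<open>\<sigma>\<close> fixes it; as all its terms lie in \<open>K\<close>, \<open>\<sigma>\<close> also maps it termwise to the sum for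
  \<open>S'\<close>.\<close>

lemma galois_conjugate_subgroup_sum:
  fixes G (structure)
  assumes G: "group G" and U: "subgroup U G" "finite U"
    and K: "complex_subfield K" and \<sigma>: "\<sigma> \<in> gal K" and conj: "galois_conjugate G \<sigma> S S'"
    and in_K: "\<And>h. h \<in> U \<Longrightarrow> rep_char S h \<in> K"
  shows "(\<Sum>h\<in>U. rep_char S' h) = (\<Sum>h\<in>U. rep_char S h)"
proof -
  have rep: "is_rep G S" using conj by (auto simp: galois_conjugate_def irrep_def split: prod.splits)
  have "linear_character G U (\<lambda>_. 1)" by (simp add: linear_character_def)
  from frobenius_reciprocity_character[OF G U rep this]
  have "(\<Sum>h\<in>U. rep_char S h) = of_int (int (card U) * rep_class G (Ind G U (\<lambda>_. 1)) S)" by simp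
  then have "(\<Sum>h\<in>U. rep_char S h) \<in> \<rat>" by simp
  then have "(\<Sum>h\<in>U. rep_char S h) = \<sigma> (\<Sum>h\<in>U. rep_char S h)" using \<sigma> by (simp add: gal_def)
  also have "\<dots> = (\<Sum>h\<in>U. \<sigma> (rep_char S h))" by (rule gal_sum[OF \<sigma> K in_K])
  also have "\<dots> = (\<Sum>h\<in>U. rep_char S' h)"
    using conj subgroup.mem_carrier[OF U(1)] by (intro sum.cong) (auto simp: galois_conjugate_def)
  finally show ?thesis by simp
qed

lemma rep_char_inv:
  fixes G (structure)
  assumes G: "group G" and rep: "is_rep G S" and h: "h \<in> carrier G"
    and g: "g \<in> carrier G" "h \<otimes> g \<otimes> h = g"
  shows "rep_char S (inv h) = rep_char S h"
proof -
  interpret group G by (rule G)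
  have "h \<otimes> (g \<otimes> h \<otimes> inv g) = g \<otimes> inv g"
    using g h by (metis inv_closed m_assoc m_closed)
  then have "inv h = g \<otimes> h \<otimes> inv g"
    using g(1) h by (intro inv_unique'[symmetric]) (auto simp: inv_comm)
  then show ?thesis using rep_char_conjugate[OF G rep g(1) h] by simp
qed

text \<open>Since \<open>\<chi> h = \<chi> (h\<^sup>-\<^sup>1)\<close>, twice the coefficient involves only the symmetrised factors
  \<open>ram_sum r z + ram_sum r (1/z)\<close>, which are \<open>k\<close> for \<open>z \<noteq> 1\<close> and \<open>2 r\<close> for \<open>z = 1\<close>. The
  coefficient is therefore a combination of the sums of \<open>\<chi>\<close> over \<open>H\<close> and over the kernel \<open>N\<close> of \<open>\<theta>\<close>.\<close>

lemma ram_induced_galois_invariant: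
  fixes G (structure)
  assumes G: "group G" and H: "subgroup H G" "finite H" and \<theta>: "linear_character G H \<theta>"
    and real: "\<And>h. h \<in> H \<Longrightarrow> \<exists>g\<in>carrier G. h \<otimes> g \<otimes> h = g"
    and \<zeta>: "primitive_root_of_unity (card H) \<zeta>" and K: "complex_subfield K" "\<zeta> \<in> K"
    and r: "int (card H) dvd r \<or> int (card H) dvd r + 1 \<or> int (card H) dvd 2 * r + 1"
  shows "galois_invariant G K (ram_induced G H \<theta> r)"
  unfolding galois_invariant_def
proof (intro ballI allI impI)
  interpret group G by (rule G)
  interpret H: subgroup H G by (rule H)
  fix \<sigma> S S' assume \<sigma>: "\<sigma> \<in> gal K" and conj: "galois_conjugate G \<sigma> S S'"
  have rep: "is_rep G S" "is_rep G S'"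
    using conj by (auto simp: galois_conjugate_def irrep_def split: prod.splits)
  have p: "card H > 0" using \<zeta> by (simp add: primitive_root_of_unity_def)
  have pow: "h [^] card H = \<one>" if "h \<in> H" for h
  proof -
    interpret HG: group "G\<lparr>carrier := H\<rparr>" by (rule H.subgroup_is_group[OF G])
    have "h [^]\<^bsub>G\<lparr>carrier := H\<rparr>\<^esub> card H = \<one>"
      using HG.pow_order_eq_1[of h] that by (simp add: order_def)
    then show ?thesis by (simp add: nat_pow_consistent[of h _ H])
  qed
  have \<theta>_pow: "\<theta> h ^ card H = 1" if h: "h \<in> H" for h
  proof -
    have pow_mem: "h [^] n \<in> H" for n :: nat using h by (induction n) auto
    have "\<theta> (h [^] n) = \<theta> h ^ n" for n :: nat
      using \<theta> h pow_mem by (induction n) (auto simp: linear_character_def)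
    then show ?thesis using pow[OF h] \<theta> by (metis linear_character_def)
  qed
  obtain k :: int where k: "\<And>z. z ^ card H = 1 \<Longrightarrow> z \<noteq> 1 \<Longrightarrow> ram_sum r z + ram_sum r (inverse z) = of_int k"
    using ram_sum_symmetrised_constant[OF p r] by blast
  define N where "N = {h \<in> H. \<theta> h = 1}"
  have N: "subgroup N G"
  proof (rule subgroupI)
    show "N \<subseteq> carrier G" by (auto simp: N_def)
    have "\<one> \<in> N" using \<theta> by (simp add: N_def linear_character_def)
    then show "N \<noteq> {}" by blast
    show "inv h \<in> N" if "h \<in> N" for h
      using that linear_character_inv(2)[OF G H(1) \<theta>, of h] by (simp add: N_def)
    show "g \<otimes> h \<in> N" if "g \<in> N" "h \<in> N" for g h
      using that \<theta> by (simp add: N_def linear_character_def)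
  qed
  have "finite N" "N \<subseteq> H" using H(2) by (auto simp: N_def)
  have formula: "2 * of_nat (card H) * of_int (ram_induced G H \<theta> r T) =
      of_int k * (\<Sum>h\<in>H. rep_char T h) + of_int (2 * r - k) * (\<Sum>h\<in>N. rep_char T h)"
    if T: "is_rep G T" for T :: "('a, nat) rep"
  proof -
    have bij: "bij_betw (\<lambda>h. inv h) H H"
      by (rule bij_betw_byWitness[where f' = "\<lambda>h. inv h"]) auto
    have inv: "rep_char T (inv h) = rep_char T h" if "h \<in> H" for h
      using real[OF that] rep_char_inv[OF G T H.mem_carrier[OF that]] by blast
    have "(\<Sum>h\<in>H. ram_sum r (\<theta> h) * rep_char T h) =
        (\<Sum>h\<in>H. ram_sum r (\<theta> (inv h)) * rep_char T (inv h))"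
      by (rule sum.reindex_bij_betw[OF bij, symmetric])
    also have "\<dots> = (\<Sum>h\<in>H. ram_sum r (inverse (\<theta> h)) * rep_char T h)"
      by (intro sum.cong refl) (simp add: inv linear_character_inv(2)[OF G H(1) \<theta>])
    finally have "2 * of_nat (card H) * of_int (ram_induced G H \<theta> r T) =
        (\<Sum>h\<in>H. ram_sum r (\<theta> h) * rep_char T h) + (\<Sum>h\<in>H. ram_sum r (inverse (\<theta> h)) * rep_char T h)"
      using ram_induced_coefficient[OF G H T \<theta>, of r] by simp
    also have "\<dots> = (\<Sum>h\<in>H. (ram_sum r (\<theta> h) + ram_sum r (inverse (\<theta> h))) * rep_char T h)"
      by (simp add: sum.distrib distrib_right)
    also have "\<dots> = (\<Sum>h\<in>H. of_int k * rep_char T h + (if \<theta> h = 1 then of_int (2 * r - k) * rep_char T h else 0))"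
    proof (intro sum.cong refl)
      fix h assume h: "h \<in> H"
      have "ram_sum r (\<theta> h) + ram_sum r (inverse (\<theta> h)) =
          of_int k + (if \<theta> h = 1 then of_int (2 * r - k) else 0)"
        using k[OF \<theta>_pow[OF h]] by (simp add: ram_sum_1)
      then show "(ram_sum r (\<theta> h) + ram_sum r (inverse (\<theta> h))) * rep_char T h =
          of_int k * rep_char T h + (if \<theta> h = 1 then of_int (2 * r - k) * rep_char T h else 0)"
        by (simp add: distrib_right)
    qed
    also have "\<dots> = of_int k * (\<Sum>h\<in>H. rep_char T h) + of_int (2 * r - k) * (\<Sum>h\<in>N. rep_char T h)"
      unfolding N_def
      by (simp only: sum.distrib sum_distrib_left sum.inter_filter[OF H(2), symmetric])
    finally show ?thesis .
  qed
  have in_K: "rep_char S h \<in> K" if "h \<in> H" for h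
    by (rule rep_char_in_cyclotomic_field[OF G rep(1) H.mem_carrier[OF that] pow[OF that] \<zeta> K])
  have "(\<Sum>h\<in>H. rep_char S' h) = (\<Sum>h\<in>H. rep_char S h)"
    by (rule galois_conjugate_subgroup_sum[OF G H K(1) \<sigma> conj in_K])
  moreover have "(\<Sum>h\<in>N. rep_char S' h) = (\<Sum>h\<in>N. rep_char S h)"
    using \<open>N \<subseteq> H\<close> by (intro galois_conjugate_subgroup_sum[OF G N \<open>finite N\<close> K(1) \<sigma> conj in_K]) blast
  ultimately have "2 * of_nat (card H) * of_int (ram_induced G H \<theta> r S') =
      2 * of_nat (card H) * (of_int (ram_induced G H \<theta> r S) :: complex)"
    by (simp only: formula[OF rep(1)] formula[OF rep(2)])
  then show "ram_induced G H \<theta> r S' = ram_induced G H \<theta> r S" using p by simp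
qed

section \<open>Hurwitz curves with automorphism group PSL(2,q)\<close>

lemma galois_invariant_sum:
  assumes "\<And>i. i \<in> I \<Longrightarrow> galois_invariant G K (f i)"
  shows "galois_invariant G K (\<Sum>i\<in>I. f i)"
  using assms unfolding galois_invariant_def sum_fun_apply by (blast intro: sum.cong)

lemma complex_subfield_Q_adjoin: "complex_subfield (Q_adjoin \<mu>)"
  unfolding Q_adjoin_def complex_subfield_def by blast

lemma Q_adjoin_generator: "\<mu> \<in> Q_adjoin \<mu>"
  by (auto simp: Q_adjoin_def)

lemma primitive_root_of_unity_power:
  assumes \<mu>: "primitive_root_of_unity n \<mu>" and p: "p dvd n"
  shows "primitive_root_of_unity p (\<mu> ^ (n div p))"
proof -
  have n: "n > 0" "\<mu> ^ n = 1" and prim: "\<And>k. 0 < k \<Longrightarrow> k < n \<Longrightarrow> \<mu> ^ k \<noteq> 1"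
    using \<mu> by (auto simp: primitive_root_of_unity_def)
  obtain m where m: "n = p * m" using p by blast
  have pm: "p > 0" "m > 0" using n(1) m by auto
  have "(\<mu> ^ m) ^ k \<noteq> 1" if "0 < k" "k < p" for k
    using prim[of "m * k"] that pm m by (simp add: power_mult)
  moreover have "(\<mu> ^ m) ^ p = 1" using n(2) m by (simp add: power_mult mult.commute)
  ultimately show ?thesis using pm m by (simp add: primitive_root_of_unity_def)
qed

text \<open>The hypotheses give \<open>84 | q\<^sup>2 - 1\<close>; the further factor \<open>2\<close> that survives the division by \<open>4\<close> comes
  from \<open>8 | q\<^sup>2 - 1\<close> for odd \<open>q\<close>.\<close>

lemma dvd_order_cyclotomic_field:
  assumes q: "coprime q (2 * 3 * 7 :: nat)" and order: "84 dvd q * (q\<^sup>2 - 1)"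
  shows "42 dvd q * (q\<^sup>2 - 1) div 4"
proof -
  have "coprime q 2" using q by (simp only: coprime_mult_right_iff)
  then have "odd q" by simp
  then obtain k where "q = 2 * k + 1" by (rule oddE)
  then have "q\<^sup>2 - 1 = 4 * (k * (k + 1))" by (simp add: power2_eq_square algebra_simps)
  moreover have "4 * 2 dvd 4 * (k * (k + 1))" by (rule mult_dvd_mono) auto
  ultimately have "8 dvd q\<^sup>2 - 1" by simp
  have "coprime (84::nat) q"
  proof -
    have "(84::nat) = 2 * (2 * 3 * 7)" by simp
    then show ?thesis using q by (metis coprime_commute coprime_mult_left_iff)
  qed
  then have "84 dvd q\<^sup>2 - 1" using order by (simp add: coprime_dvd_mult_right_iff)
  with \<open>8 dvd q\<^sup>2 - 1\<close> have "lcm 8 84 dvd q\<^sup>2 - 1" by (rule lcm_least)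
  moreover have "lcm 8 (84::nat) = 168" by (simp add: lcm_nat_def gcd_nat.simps)
  ultimately obtain m where "q\<^sup>2 - 1 = 168 * m" by auto
  then have "q * (q\<^sup>2 - 1) div 4 = 42 * (q * m)" by simp
  then show ?thesis by simp
qed

lemma aut_group_conjugate_to_inverse:
  fixes X :: "'n::finite proj set"
  assumes iso: "aut_group X \<cong> (PSL2 :: ('f::{field,finite}^2^2) set monoid)"
    and h: "h \<in> carrier (aut_group X)" "h [^]\<^bsub>aut_group X\<^esub> (n::nat) = \<one>\<^bsub>aut_group X\<^esub>"
    and n: "coprime n CARD('f)" and two: "coprime 2 CARD('f)"
  shows "\<exists>g\<in>carrier (aut_group X). h \<otimes>\<^bsub>aut_group X\<^esub> g \<otimes>\<^bsub>aut_group X\<^esub> h = g"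
proof -
  interpret group "aut_group X" by (rule group_aut_group)
  obtain \<phi> where \<phi>: "\<phi> \<in> hom (aut_group X) (PSL2 :: ('f^2^2) set monoid)"
    "\<phi> ` carrier (aut_group X) = carrier PSL2" "inj_on \<phi> (carrier (aut_group X))"
    using iso unfolding is_iso_def by (auto simp: iso_iff)
  interpret \<phi>: group_hom "aut_group X" "PSL2 :: ('f^2^2) set monoid" \<phi>
    by (intro group_hom.intro group_hom_axioms.intro group_aut_group PSL2_group \<phi>(1))
  have "\<phi> h [^]\<^bsub>PSL2\<^esub> n = \<one>\<^bsub>PSL2\<^esub>" using \<phi>.hom_nat_pow[OF h(1), of n] h(2) by simp
  moreover have "of_nat n \<noteq> (0::'f)" by (rule of_nat_neq_0_if_coprime_card[OF n])
  moreover have "2 \<noteq> (0::'f)" using of_nat_neq_0_if_coprime_card[OF two] by simp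
  ultimately obtain y where y: "y \<in> carrier (PSL2 :: ('f^2^2) set monoid)"
    "\<phi> h \<otimes>\<^bsub>PSL2\<^esub> y \<otimes>\<^bsub>PSL2\<^esub> \<phi> h = y"
    using PSL2_conjugate_to_inverse[OF \<phi>.hom_closed[OF h(1)]] by blast
  then obtain g where g: "g \<in> carrier (aut_group X)" "y = \<phi> g" using \<phi>(2) by blast
  have "\<phi> (h \<otimes>\<^bsub>aut_group X\<^esub> g \<otimes>\<^bsub>aut_group X\<^esub> h) = \<phi> g"
    using y(2) g h(1) by simp
  then show ?thesis using g(1) h(1) inj_onD[OF \<phi>(3)] by blast
qed

theorem theorem7:
  fixes X :: "'n::finite proj set"
    and P\<^sub>1 :: "'n proj"
    and q :: nat
    and \<mu> :: complex
    and r\<^sub>1 r\<^sub>2 r\<^sub>3 r\<^sub>7 :: int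
    and D :: "'n proj \<Rightarrow> int"
  assumes "hurwitz_curve X"
    and "aut_group X \<cong> (PSL2 :: ('f::{field,finite}^2^2) set monoid)"
    and "q = CARD('f)"
    and "coprime q (2 * 3 * 7)"
    and "primitive_root_of_unity (q * (q\<^sup>2 - 1) div 4) \<mu>"
    and "P\<^sub>1 \<in> X" and "card (stab X P\<^sub>1) = 1"
    and "D = (\<lambda>P. r\<^sub>1 * reduced_divisor (orbit (aut_group X) (\<lambda>g. g) P\<^sub>1) P
                + r\<^sub>2 * stab_divisor X 2 P
                + r\<^sub>3 * stab_divisor X 3 P
                + r\<^sub>7 * stab_divisor X 7 P)"
    and "r\<^sub>7 mod 7 \<in> {0, 3, 6}"
  shows "galois_invariant (aut_group X) (Q_adjoin \<mu>) (deg_eq X D)"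
proof -
  interpret group "aut_group X" by (rule group_aut_group)
  have X: "smooth_projective_curve X" using assms(1) by (simp add: hurwitz_curve_def)
  obtain g where g: "g > 1" "card (carrier (aut_group X)) = 84 * (g - 1)"
    using assms(1) by (auto simp: hurwitz_curve_def order_def)
  then have fin: "finite (carrier (aut_group X))" by (intro card_ge_0_finite) simp
  have "84 dvd card (carrier (aut_group X))" unfolding g(2) by simp
  also have "card (carrier (aut_group X)) = card (carrier (PSL2 :: ('f^2^2) set monoid))"
    by (rule iso_same_card[OF assms(2)])
  also have "\<dots> dvd q * (q\<^sup>2 - 1)" unfolding assms(3) by (rule card_PSL2_dvd)
  finally have n: "42 dvd q * (q\<^sup>2 - 1) div 4" by (rule dvd_order_cyclotomic_field[OF assms(4)])

  have orbit: "galois_invariant (aut_group X) (Q_adjoin \<mu>) (deg_eq_orbit X P r)"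
    if P: "P \<in> X" and p: "card (stab X P) dvd 42"
      and r: "int (card (stab X P)) dvd r \<or> int (card (stab X P)) dvd r + 1 \<or> int (card (stab X P)) dvd 2 * r + 1"
    for P r
  proof -
    let ?H = "stab X P"
    interpret H: subgroup ?H "aut_group X" by (rule subgroup_stab[OF P])
    have finH: "finite ?H" using fin H.subset by (rule finite_subset[rotated])
    have "coprime 42 CARD('f)" using assms(3,4) by (simp add: coprime_commute)
    with p have "coprime (card ?H) CARD('f)" by (rule coprime_divisors[OF _ dvd_refl])
    moreover have "coprime 2 CARD('f)" using assms(3,4) by (auto simp: coprime_commute)
    moreover have "h [^]\<^bsub>aut_group X\<^esub> card ?H = \<one>\<^bsub>aut_group X\<^esub>" if "h \<in> ?H" for h
    proof -
      interpret HG: group "aut_group X\<lparr>carrier := ?H\<rparr>" by (rule H.subgroup_is_group[OF group_aut_group])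
      show ?thesis
        using HG.pow_order_eq_1[of h] that by (simp add: order_def nat_pow_consistent[of h _ ?H])
    qed
    ultimately have real: "\<exists>g\<in>carrier (aut_group X). h \<otimes>\<^bsub>aut_group X\<^esub> g \<otimes>\<^bsub>aut_group X\<^esub> h = g" if "h \<in> ?H" for h
      using aut_group_conjugate_to_inverse[OF assms(2) H.mem_carrier[OF that]] that by blast
    have dvd: "card ?H dvd q * (q\<^sup>2 - 1) div 4" using p n by (rule dvd_trans)
    let ?\<zeta> = "\<mu> ^ (q * (q\<^sup>2 - 1) div 4 div card ?H)"
    have "?\<zeta> \<in> Q_adjoin \<mu>"
      by (rule complex_subfield_power[OF complex_subfield_Q_adjoin Q_adjoin_generator])
    from ram_induced_galois_invariant[OF group_aut_group subgroup_stab[OF P] finH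
        ram_char_linear_character[OF X P] real primitive_root_of_unity_power[OF assms(5) dvd]
        complex_subfield_Q_adjoin this r]
    show ?thesis by (simp add: deg_eq_orbit_def ram_induced_def)
  qed
  have point: "galois_invariant (aut_group X) (Q_adjoin \<mu>) (deg_eq_orbit X P (D P))" if P: "P \<in> X" for P
  proof -
    let ?O = "orbit (aut_group X) (\<lambda>g. g) P\<^sub>1"
    have O: "card (stab X P) = 1" if "P \<in> ?O" by (rule card_stab_orbit[OF assms(6) that assms(7)])
    have D: "D P = r\<^sub>1 * (if P \<in> ?O then 1 else 0) + r\<^sub>2 * (if card (stab X P) = 2 then 1 else 0)
        + r\<^sub>3 * (if card (stab X P) = 3 then 1 else 0) + r\<^sub>7 * (if card (stab X P) = 7 then 1 else 0)"
      using P by (simp add: assms(8) reduced_divisor_def stab_divisor_def)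
    consider "card (stab X P) = 1" | "card (stab X P) = 2" | "card (stab X P) = 3"
      | "card (stab X P) = 7"
      | "P \<notin> ?O" "card (stab X P) \<noteq> 2" "card (stab X P) \<noteq> 3" "card (stab X P) \<noteq> 7"
      using O by blast
    then show ?thesis
    proof cases
      case 1
      then show ?thesis by (intro orbit P) simp_all
    next
      case 2
      have "2 dvd D P \<or> 2 dvd D P + 1" by presburger
      then show ?thesis using 2 by (intro orbit P) auto
    next
      case 3
      have "3 dvd D P \<or> 3 dvd D P + 1 \<or> 3 dvd 2 * D P + 1" by presburger
      then show ?thesis using 3 by (intro orbit P) auto
    next
      case 4
      then have "D P = r\<^sub>7" using O by (auto simp: D)
      moreover have "7 dvd r\<^sub>7 \<or> 7 dvd r\<^sub>7 + 1 \<or> 7 dvd 2 * r\<^sub>7 + 1" using assms(9) by auto presburger+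
      ultimately show ?thesis using 4 by (intro orbit P) auto
    next
      case 5
      then have "D P = 0" by (simp add: D)
      then show ?thesis by (simp add: deg_eq_orbit_def galois_invariant_def)
    qed
  qed
  have "(SOME P. P \<in> Y) \<in> X" if "Y \<in> orbits (aut_group X) X (\<lambda>g. g)" for Y
  proof -
    obtain P where P: "P \<in> X" "Y = orbit (aut_group X) (\<lambda>g. g) P"
      using \<open>Y \<in> _\<close> by (auto simp: orbits_def)
    have "\<one>\<^bsub>aut_group X\<^esub> P \<in> Y" using P(2) one_closed unfolding orbit_def by blast
    then have "(SOME P. P \<in> Y) \<in> Y" by (rule someI)
    moreover have "Y \<subseteq> X" using P aut_group_closed by (auto simp: orbit_def)
    ultimately show ?thesis by blast
  qed
  then show ?thesis
    unfolding deg_eq_def Let_def by (intro galois_invariant_sum point) blast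
qed

end
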